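(* Let $\phi:\mathbb{R}\to\mathbb{R}$ be even, convex and $C^\infty$ with $x\mapsto\phi(|x|)$ real analytic on $\mathbb{R}^n$, let $a(x)=e^{\phi(|x|)}$, and let $\alpha$ be the measure on $\mathbb{R}^n$ with $d\alpha=a\,dx$. Let $\Omega\subset\mathbb{R}^n$ be a bounded $C^\infty$ domain, let $\Lambda_1(\Omega)$ be the lowest eigenvalue of the weighted clamped plate problem $$\mathcal{A}^2u=\Lambda u \ \text{ in }\Omega,\qquad u=0\ \text{ and }\ \frac{\partial u}{\partial\nu}=0\ \text{ on }\partial\Omega,$$ and let $\Omega^{\#}$ be the centered ball with $\alpha(\Omega^{\#})=\alpha(\Omega)$. Assume that either $n\ge 3$, or $n=2$ and the ground state for $\Omega^{\#}$ is radial. Then $$\Lambda_1(\Omega)\ \ge\ C\,\Lambda_1(\Omega^{\#})$$ for some constant $C=C(\alpha(\Omega),n)$ with $0<C\le 1$ which (for the given weight $a$) depends on $\Omega$ only through its $\alpha$-measure $\alpha(\Omega)$, and on the dimension $n$.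
   Context: The Laplacian with drift is $\mathcal{A}u=\frac1a\nabla\cdot(a\nabla u)=\Delta u+\nabla\phi\cdot\nabla u$, where $\phi$ also denotes the radial extension $x\mapsto\phi(|x|)$ to $\mathbb{R}^n$; $\mathcal{A}^2u=\mathcal{A}(\mathcal{A}u)$. $\frac{\partial}{\partial\nu}$ is the exterior normal derivative. A centered ball is a ball $\{x\in\mathbb{R}^n:|x|<R\}$ centered at the origin. $\Lambda_1(\Omega^{\#})$ is the lowest eigenvalue of the same problem with $\Omega$ replaced by $\Omega^{\#}$. Weakly, $\Lambda$ is an eigenvalue on $\Omega$ with eigenfunction $u\in H_0^2(\Omega,\alpha)\setminus\{0\}$ if $\int_\Omega(\mathcal{A}u)(\mathcal{A}v)\,d\alpha=\Lambda\int_\Omega uv\,d\alpha$ for all $v\in H_0^2(\Omega,\alpha)$, where $H_0^2(\Omega,\alpha)$ is the closure of $C_c^\infty(\Omega)$ in the norm $\left(\int_\Omega(|D^2u|^2+|\nabla u|^2+u^2)\,d\alpha\right)^{1/2}$. The ground state for $\Omega^{\#}$ is an eigenfunction for $\Lambda_1(\Omega^{\#})$. *)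

theory Defs
  imports "HOL-Analysis.Analysis"
begin

section \<open>Smooth and real analytic functions\<close>

definition smooth_real :: "(real \<Rightarrow> real) \<Rightarrow> bool" where
  "smooth_real f \<longleftrightarrow> (\<forall>k x. ((deriv ^^ k) f) differentiable (at x))"

definition partial_deriv :: "'n::finite \<Rightarrow> (real^'n \<Rightarrow> real) \<Rightarrow> real^'n \<Rightarrow> real" where
  "partial_deriv i f x = frechet_derivative f (at x) (axis i 1)"

text \<open>For open \<open>S\<close> this is membership in $C^\infty(S)$: every iterated partial derivative is
  Frechet differentiable, hence continuous, on \<open>S\<close>.\<close>

definition smooth_on :: "(real^'n::finite) set \<Rightarrow> (real^'n \<Rightarrow> real) \<Rightarrow> bool" where
  "smooth_on S f \<longleftrightarrow> (\<forall>is. \<forall>x\<in>S. foldr partial_deriv is f differentiable (at x))"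

text \<open>Local expansion into a power series in several variables; the coefficients are indexed by
  multi-indices \<open>'n \<Rightarrow> nat\<close>.\<close>

definition real_analytic :: "(real^'n::finite \<Rightarrow> real) \<Rightarrow> bool" where
  "real_analytic f \<longleftrightarrow>
     (\<forall>x0. \<exists>r>0. \<exists>c :: ('n \<Rightarrow> nat) \<Rightarrow> real. \<forall>x\<in>ball x0 r.
        ((\<lambda>k. c k * (\<Prod>i\<in>UNIV. (x $ i - x0 $ i) ^ k i)) has_sum f x) UNIV)"


section \<open>Bounded smooth domains\<close>

text \<open>Near each boundary point, \<open>\<Omega>\<close> is the sublevel set of a smooth function without critical
  points; so the boundary is a smooth hypersurface with \<open>\<Omega>\<close> locally on one side of it.\<close>

definition smooth_boundary :: "(real^'n::finite) set \<Rightarrow> bool" where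
  "smooth_boundary \<Omega> \<longleftrightarrow>
     (\<forall>p\<in>frontier \<Omega>. \<exists>U \<rho>. open U \<and> p \<in> U \<and> smooth_on U \<rho> \<and>
        (\<forall>x\<in>U. \<exists>i. partial_deriv i \<rho> x \<noteq> 0) \<and> \<Omega> \<inter> U = {x\<in>U. \<rho> x < 0})"

definition bounded_smooth_domain :: "(real^'n::finite) set \<Rightarrow> bool" where
  "bounded_smooth_domain \<Omega> \<longleftrightarrow>
     open \<Omega> \<and> connected \<Omega> \<and> \<Omega> \<noteq> {} \<and> bounded \<Omega> \<and> smooth_boundary \<Omega>"


section \<open>Test functions and weak derivatives\<close>

definition test_functions :: "(real^'n::finite) set \<Rightarrow> (real^'n \<Rightarrow> real) set" where
  "test_functions \<Omega> =
     {\<psi>. smooth_on UNIV \<psi> \<and> compact (closure {x. \<psi> x \<noteq> 0}) \<and> closure {x. \<psi> x \<noteq> 0} \<subseteq> \<Omega>}"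

definition locally_integrable :: "(real^'n::finite) set \<Rightarrow> (real^'n \<Rightarrow> real) \<Rightarrow> bool" where
  "locally_integrable \<Omega> u \<longleftrightarrow> (\<forall>K. compact K \<longrightarrow> K \<subseteq> \<Omega> \<longrightarrow> set_integrable lborel K u)"

definition has_weak_partial ::
    "(real^'n::finite) set \<Rightarrow> 'n \<Rightarrow> (real^'n \<Rightarrow> real) \<Rightarrow> (real^'n \<Rightarrow> real) \<Rightarrow> bool" where
  "has_weak_partial \<Omega> i u g \<longleftrightarrow>
     locally_integrable \<Omega> u \<and> locally_integrable \<Omega> g \<and>
     (\<forall>\<psi>\<in>test_functions \<Omega>.
        (LINT x:\<Omega>|lborel. u x * partial_deriv i \<psi> x) = - (LINT x:\<Omega>|lborel. g x * \<psi> x))"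

text \<open>Meaningful when a weak derivative exists; on open \<open>\<Omega>\<close> the choice is then unique up to
  null sets.\<close>

definition weak_partial ::
    "(real^'n::finite) set \<Rightarrow> 'n \<Rightarrow> (real^'n \<Rightarrow> real) \<Rightarrow> real^'n \<Rightarrow> real" where
  "weak_partial \<Omega> i u = (SOME g. has_weak_partial \<Omega> i u g)"


section \<open>Weighted Sobolev spaces\<close>

definition weighted_measure :: "(real \<Rightarrow> real) \<Rightarrow> (real^'n::finite) measure" where
  "weighted_measure \<phi> = density lborel (\<lambda>x. ennreal (exp (\<phi> (norm x))))"

definition weighted_L2 :: "(real \<Rightarrow> real) \<Rightarrow> (real^'n::finite) set \<Rightarrow> (real^'n \<Rightarrow> real) set" where
  "weighted_L2 \<phi> \<Omega> =
     {u. set_borel_measurable lborel \<Omega> u \<and> set_integrable (weighted_measure \<phi>) \<Omega> (\<lambda>x. (u x)\<^sup>2)}"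

definition weighted_H2 :: "(real \<Rightarrow> real) \<Rightarrow> (real^'n::finite) set \<Rightarrow> (real^'n \<Rightarrow> real) set" where
  "weighted_H2 \<phi> \<Omega> =
     {u \<in> weighted_L2 \<phi> \<Omega>. \<forall>i.
        has_weak_partial \<Omega> i u (weak_partial \<Omega> i u) \<and> weak_partial \<Omega> i u \<in> weighted_L2 \<phi> \<Omega> \<and>
        (\<forall>j. has_weak_partial \<Omega> j (weak_partial \<Omega> i u) (weak_partial \<Omega> j (weak_partial \<Omega> i u)) \<and>
             weak_partial \<Omega> j (weak_partial \<Omega> i u) \<in> weighted_L2 \<phi> \<Omega>)}"

text \<open>The norm of \<open>u - \<psi>\<close> for \<open>\<psi>\<close> a test function, whose weak derivatives are its
  classical ones.\<close>

definition H2_dist_test ::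
    "(real \<Rightarrow> real) \<Rightarrow> (real^'n::finite) set \<Rightarrow> (real^'n \<Rightarrow> real) \<Rightarrow> (real^'n \<Rightarrow> real) \<Rightarrow> real" where
  "H2_dist_test \<phi> \<Omega> u \<psi> = sqrt (LINT x:\<Omega>|weighted_measure \<phi>.
       (\<Sum>i\<in>UNIV. \<Sum>j\<in>UNIV.
          (weak_partial \<Omega> j (weak_partial \<Omega> i u) x - partial_deriv j (partial_deriv i \<psi>) x)\<^sup>2)
     + (\<Sum>i\<in>UNIV. (weak_partial \<Omega> i u x - partial_deriv i \<psi> x)\<^sup>2)
     + (u x - \<psi> x)\<^sup>2)"

definition weighted_H2_0 :: "(real \<Rightarrow> real) \<Rightarrow> (real^'n::finite) set \<Rightarrow> (real^'n \<Rightarrow> real) set" where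
  "weighted_H2_0 \<phi> \<Omega> =
     {u \<in> weighted_H2 \<phi> \<Omega>. \<exists>\<psi>. (\<forall>k::nat. \<psi> k \<in> test_functions \<Omega>) \<and>
        (\<lambda>k. H2_dist_test \<phi> \<Omega> u (\<psi> k)) \<longlonglongrightarrow> 0}"


section \<open>The weighted clamped plate problem\<close>

definition drift_laplacian ::
    "(real \<Rightarrow> real) \<Rightarrow> (real^'n::finite) set \<Rightarrow> (real^'n \<Rightarrow> real) \<Rightarrow> real^'n \<Rightarrow> real" where
  "drift_laplacian \<phi> \<Omega> u x =
     (\<Sum>i\<in>UNIV. weak_partial \<Omega> i (weak_partial \<Omega> i u) x)
   + (\<Sum>i\<in>UNIV. partial_deriv i (\<lambda>y. \<phi> (norm y)) x * weak_partial \<Omega> i u x)"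

definition plate_eigenfunction ::
    "(real \<Rightarrow> real) \<Rightarrow> (real^'n::finite) set \<Rightarrow> real \<Rightarrow> (real^'n \<Rightarrow> real) \<Rightarrow> bool" where
  "plate_eigenfunction \<phi> \<Omega> \<Lambda> u \<longleftrightarrow>
     u \<in> weighted_H2_0 \<phi> \<Omega> \<and> \<not> (AE x in weighted_measure \<phi>. x \<in> \<Omega> \<longrightarrow> u x = 0) \<and>
     (\<forall>v\<in>weighted_H2_0 \<phi> \<Omega>.
        (LINT x:\<Omega>|weighted_measure \<phi>. drift_laplacian \<phi> \<Omega> u x * drift_laplacian \<phi> \<Omega> v x)
        = \<Lambda> * (LINT x:\<Omega>|weighted_measure \<phi>. u x * v x))"

definition plate_eigenvalue :: "(real \<Rightarrow> real) \<Rightarrow> (real^'n::finite) set \<Rightarrow> real \<Rightarrow> bool" where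
  "plate_eigenvalue \<phi> \<Omega> \<Lambda> \<longleftrightarrow> (\<exists>u. plate_eigenfunction \<phi> \<Omega> \<Lambda> u)"

definition lowest_plate_eigenvalue :: "(real \<Rightarrow> real) \<Rightarrow> (real^'n::finite) set \<Rightarrow> real \<Rightarrow> bool" where
  "lowest_plate_eigenvalue \<phi> \<Omega> \<Lambda> \<longleftrightarrow>
     plate_eigenvalue \<phi> \<Omega> \<Lambda> \<and> (\<forall>\<mu>. plate_eigenvalue \<phi> \<Omega> \<mu> \<longrightarrow> \<Lambda> \<le> \<mu>)"

definition radial_on :: "(real^'n::finite) set \<Rightarrow> (real^'n \<Rightarrow> real) \<Rightarrow> bool" where
  "radial_on \<Omega> u \<longleftrightarrow> (\<exists>f. AE x in lborel. x \<in> \<Omega> \<longrightarrow> u x = f (norm x))"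

end

theory Submission
  imports Defs
begin

text \<open>
  It suffices to bound $\Lambda_1(\Omega)$ below by a positive constant depending only on
  $\alpha(\Omega)$, because the ball $\Omega^\#$, hence $\Lambda_1(\Omega^\#)$, is determined by
  $\alpha(\Omega)$. Since $\phi$ is even and convex, $a(x) \ge e^{\phi(0)}$, which bounds the Lebesgue measure
  of $\Omega$, and $a(x) \le a(x + th)$ whenever $x \cdot h \ge 0$ and $t \ge 0$. Let $B$ be a centered ball of
  radius $L$ with $|B| \ge 4|\Omega|$, and integrate $|\psi(x + h) - \psi(x)|^2 a(x)$ over all $x$ and $h \in B$
  with $x \cdot h \ge 0$. For fixed $h$ the integral is at most $L^2 \int |\nabla\psi|^2 d\alpha$ by the monotonicity
  of $a$; for fixed $x$, at least a quarter of $B$ consists of admissible $h$ with $x + h \notin \Omega$, where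
  the integrand is $\psi(x)^2 a(x)$. Hence
  $\int \psi^2 d\alpha \le 4L^2 \int |\nabla\psi|^2 d\alpha$, and with
  $\int |\nabla\psi|^2 d\alpha = -\int \psi \mathcal{A}\psi\, d\alpha$ this gives
  $\int \psi^2 d\alpha \le (4L^2)^2 \int (\mathcal{A}\psi)^2 d\alpha$.
\<close>

section \<open>A weighted Poincare inequality\<close>

text \<open>The fundamental theorem of calculus makes the increment the mean of the directional
  derivative over the segment, so its square is at most the mean of the squares; Cauchy-Schwarz then
  splits off \<open>norm h\<close>. The bound is a nonnegative integral so that it can be fed to
  Tonelli's theorem.\<close>

lemma increment_square_le:
  fixes \<psi> :: "'a::euclidean_space \<Rightarrow> real" and G :: "'a \<Rightarrow> 'a"
  assumes deriv: "\<And>x. (\<psi> has_derivative (\<lambda>h. G x \<bullet> h)) (at x)"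
    and cont: "continuous_on UNIV G"
  shows "ennreal ((\<psi> (x + h) - \<psi> x)\<^sup>2) \<le>
    (\<integral>\<^sup>+t. ennreal ((norm h)\<^sup>2 * (norm (G (x + t *\<^sub>R h)))\<^sup>2) * indicator {0..1::real} t \<partial>lborel)"
proof -
  define c where "c = \<psi> (x + h) - \<psi> x"
  define f where "f = (\<lambda>t. G (x + t *\<^sub>R h) \<bullet> h)"
  have contf: "continuous_on S f" for S
    unfolding f_def by (intro continuous_intros continuous_on_compose2[OF cont]) auto
  have "((\<lambda>t. \<psi> (x + t *\<^sub>R h)) has_vector_derivative f t) (at t within {0..1})" for t
  proof -
    have "((\<lambda>t. x + t *\<^sub>R h) has_derivative (\<lambda>s. s *\<^sub>R h)) (at t)"
      by (auto intro!: derivative_eq_intros)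
    from diff_chain_at[OF this deriv]
    have "((\<lambda>t. \<psi> (x + t *\<^sub>R h)) has_derivative (\<lambda>s. s *\<^sub>R f t)) (at t)"
      by (simp add: o_def f_def)
    then show ?thesis
      unfolding has_vector_derivative_def by (rule has_derivative_at_withinI)
  qed
  then have f1: "(f has_integral c) {0..1}"
    using fundamental_theorem_of_calculus[of 0 1 "\<lambda>t. \<psi> (x + t *\<^sub>R h)" f] by (simp add: c_def)
  define J where "J = integral {0..1} (\<lambda>t. (f t)\<^sup>2)"
  have f2: "((\<lambda>t. (f t)\<^sup>2) has_integral J) {0..1}"
    unfolding J_def by (intro integrable_integral integrable_continuous_interval continuous_intros contf)
  \<comment> \<open>Jensen's inequality by hand: \<open>c\<close> is the mean of \<open>f\<close>,
    and the integral of the square of \<open>f t - c\<close> is nonnegative.\<close>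
  have "((\<lambda>t. (f t)\<^sup>2 - 2 * c * f t + c\<^sup>2) has_integral (J - 2 * c * c + c\<^sup>2)) {0..1}"
    using has_integral_add[OF has_integral_diff[OF f2 has_integral_mult_right[OF f1, of "2 * c"]]
        has_integral_const_real[of "c\<^sup>2" 0 1]] by simp
  then have "0 \<le> J - 2 * c * c + c\<^sup>2"
  proof (rule has_integral_nonneg)
    fix t show "0 \<le> (f t)\<^sup>2 - 2 * c * f t + c\<^sup>2"
      using zero_le_power2[of "f t - c"] by (simp add: power2_diff mult_ac)
  qed
  then have "c\<^sup>2 \<le> J"
    by (simp add: power2_eq_square)
  also have "J \<le> integral {0..1} (\<lambda>t. (norm h)\<^sup>2 * (norm (G (x + t *\<^sub>R h)))\<^sup>2)"
    unfolding J_def f_def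
  proof (intro integral_le integrable_continuous_interval continuous_intros continuous_on_compose2[OF cont])
    fix t
    show "(G (x + t *\<^sub>R h) \<bullet> h)\<^sup>2 \<le> (norm h)\<^sup>2 * (norm (G (x + t *\<^sub>R h)))\<^sup>2"
      using Cauchy_Schwarz_ineq2[of "G (x + t *\<^sub>R h)" h]
      by (metis abs_le_square_iff abs_mult abs_norm_cancel mult.commute power_mult_distrib)
  qed auto
  finally have le: "c\<^sup>2 \<le> integral {0..1} (\<lambda>t. (norm h)\<^sup>2 * (norm (G (x + t *\<^sub>R h)))\<^sup>2)" .
  have "(\<integral>\<^sup>+t. ennreal ((norm h)\<^sup>2 * (norm (G (x + t *\<^sub>R h)))\<^sup>2) * indicator {0..1::real} t \<partial>lborel)
     = (\<integral>\<^sup>+t. ennreal (indicator {0..1::real} t * ((norm h)\<^sup>2 * (norm (G (x + t *\<^sub>R h)))\<^sup>2)) \<partial>lborel)"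
    by (intro nn_integral_cong) (auto simp: indicator_def)
  also have "\<dots> = ennreal (integral {0..1} (\<lambda>t. (norm h)\<^sup>2 * (norm (G (x + t *\<^sub>R h)))\<^sup>2))"
  proof (rule nn_integral_has_integral_lborel)
    show "(\<lambda>t. indicator {0..1::real} t * ((norm h)\<^sup>2 * (norm (G (x + t *\<^sub>R h)))\<^sup>2)) \<in> borel_measurable borel"
      by (intro borel_measurable_times borel_measurable_indicator borel_measurable_continuous_onI
          continuous_intros continuous_on_compose2[OF cont]) auto
    have "((\<lambda>t. (norm h)\<^sup>2 * (norm (G (x + t *\<^sub>R h)))\<^sup>2) has_integral
        integral {0..1} (\<lambda>t. (norm h)\<^sup>2 * (norm (G (x + t *\<^sub>R h)))\<^sup>2)) {0..1}"
      by (intro integrable_integral integrable_continuous_interval continuous_intros continuous_on_compose2[OF cont]) auto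
    then show "((\<lambda>t. indicator {0..1::real} t * ((norm h)\<^sup>2 * (norm (G (x + t *\<^sub>R h)))\<^sup>2)) has_integral
        integral {0..1} (\<lambda>t. (norm h)\<^sup>2 * (norm (G (x + t *\<^sub>R h)))\<^sup>2)) UNIV"
      unfolding has_integral_restrict_UNIV[of "{0..1}", symmetric]
      by (rule has_integral_eq[rotated]) (auto simp: indicator_def)
  qed auto
  finally show ?thesis
    using le by (simp add: c_def ennreal_leI)
qed

lemma nn_integral_lborel_translate:
  fixes f :: "'a::euclidean_space \<Rightarrow> ennreal"
  assumes "f \<in> borel_measurable borel"
  shows "(\<integral>\<^sup>+x. f (x + h) \<partial>lborel) = (\<integral>\<^sup>+x. f x \<partial>lborel)"
proof -
  have "(\<integral>\<^sup>+x. f x \<partial>lborel) = (\<integral>\<^sup>+x. f x \<partial>distr lborel borel (\<lambda>x. h + x))"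
    by (simp add: lborel_distr_plus)
  also have "\<dots> = (\<integral>\<^sup>+x. f (x + h) \<partial>lborel)"
    using assms by (subst nn_integral_distr) (auto simp: add.commute)
  finally show ?thesis ..
qed

text \<open>The two closed half balls cover the ball, and reflection in the origin exchanges them.
  Only an inequality can hold for all \<open>x\<close>, since for \<open>x = 0\<close> each half is
  the whole ball.\<close>

lemma emeasure_ball_le_half_ball:
  fixes x :: "'a::euclidean_space"
  shows "emeasure lborel (ball (0::'a) L) \<le> 2 * emeasure lborel {h \<in> ball 0 L. 0 \<le> x \<bullet> h}"
proof -
  let ?H = "{h \<in> ball 0 L. 0 \<le> x \<bullet> h}" and ?H' = "{h \<in> ball 0 L. x \<bullet> h \<le> 0}"
  have [measurable]: "?H \<in> sets borel" "?H' \<in> sets borel"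
    by measurable
  have "emeasure lborel ?H' = emeasure lborel ?H"
  proof -
    \<comment> \<open>Reflection invariance of Lebesgue measure is the affine change of variables
      with factor -1, whose Jacobian is 1.\<close>
    have "lborel = density (distr lborel borel (\<lambda>h::'a. 0 + (-1) *\<^sub>R h)) (\<lambda>_. (\<bar>-1::real\<bar>^DIM('a)))"
      by (rule lborel_affine) simp
    then have "(lborel :: 'a measure) = distr lborel borel uminus"
      by (simp add: density_1 one_ennreal_def[symmetric])
    then have "emeasure lborel ?H' = emeasure (distr lborel borel uminus) ?H'"
      by metis
    also have "\<dots> = emeasure lborel (uminus -` ?H')"
      by (subst emeasure_distr) auto
    also have "uminus -` ?H' = ?H"
      by auto
    finally show ?thesis .
  qed
  moreover have "emeasure lborel (ball (0::'a) L) \<le> emeasure lborel (?H \<union> ?H')"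
    by (rule emeasure_mono) auto
  moreover have "emeasure lborel (?H \<union> ?H') \<le> emeasure lborel ?H + emeasure lborel ?H'"
    by (rule emeasure_subadditive) auto
  ultimately show ?thesis
    by (simp add: mult_2)
qed

text \<open>Increments are integrated over pairs \<open>(x, h)\<close> and estimated from below for
  fixed \<open>x\<close> and from above for fixed \<open>h\<close>. The geometry of the weight
  enters through \<open>a_mono\<close>: along an admissible \<open>h\<close> the weight at the start
  of a segment is dominated by the weight at each of its points.\<close>

lemma weighted_poincare:
  fixes \<psi> a :: "'a::euclidean_space \<Rightarrow> real" and G :: "'a \<Rightarrow> 'a"
  assumes deriv: "\<And>x. (\<psi> has_derivative (\<lambda>h. G x \<bullet> h)) (at x)"
    and contG: "continuous_on UNIV G"
    and a[measurable]: "a \<in> borel_measurable borel" and a_nonneg: "\<And>x. 0 \<le> a x"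
    and a_mono: "\<And>x h. 0 \<le> x \<bullet> h \<Longrightarrow> a x \<le> a (x + h)"
    and A[measurable]: "A \<in> sets borel" and supp: "\<And>x. x \<notin> A \<Longrightarrow> \<psi> x = 0"
    and L: "0 < L" "4 * emeasure lborel A \<le> emeasure lborel (ball (0::'a) L)"
  shows "(\<integral>\<^sup>+x. ennreal (a x * (\<psi> x)\<^sup>2) \<partial>lborel)
    \<le> ennreal (4 * L\<^sup>2) * (\<integral>\<^sup>+x. ennreal (a x * (norm (G x))\<^sup>2) \<partial>lborel)"
proof -
  define B where "B = ball (0::'a) L"
  define bm where "bm = measure lborel B"
  have B: "emeasure lborel B = ennreal bm" "0 < bm"
    using L(1) emeasure_lborel_ball_finite[of "0::'a" L] content_ball_gt_0_iff[of "0::'a" L]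
    by (auto simp: B_def bm_def intro!: emeasure_eq_ennreal_measure)
  have [measurable]: "B \<in> sets borel"
    by (simp add: B_def)
  have [measurable]: "\<psi> \<in> borel_measurable borel" "G \<in> borel_measurable borel"
    using contG deriv
    by (auto intro!: borel_measurable_continuous_onI has_derivative_continuous_on[where s=UNIV])
  let ?E = "\<integral>\<^sup>+x. ennreal (a x * (\<psi> x)\<^sup>2) \<partial>lborel"
  let ?D = "\<integral>\<^sup>+x. ennreal (a x * (norm (G x))\<^sup>2) \<partial>lborel"
  let ?F = "\<lambda>x h. ennreal (a x * (\<psi> (x + h) - \<psi> x)\<^sup>2) * indicator {h \<in> B. 0 \<le> x \<bullet> h} h"
  \<comment> \<open>The admissible half ball has measure at least \<open>bm / 2\<close>; the
    \<open>h\<close> carrying \<open>x\<close> into \<open>A\<close> have measure at most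
    \<open>bm / 4\<close>. At least \<open>bm / 4\<close> remains, and there
    \<open>\<psi> (x + h) = 0\<close>.\<close>
  have lower: "ennreal (a x * (\<psi> x)\<^sup>2) * ennreal bm \<le> 4 * (\<integral>\<^sup>+h. ?F x h \<partial>lborel)" for x
  proof -
    let ?H = "{h \<in> B. 0 \<le> x \<bullet> h}" and ?A = "{h. x + h \<in> A}"
    have "emeasure lborel ?A = (\<integral>\<^sup>+h. indicator ?A h \<partial>lborel)"
      by simp
    also have "\<dots> = (\<integral>\<^sup>+h. indicator A (h + x) \<partial>lborel)"
      by (intro nn_integral_cong) (auto simp: indicator_def add.commute)
    also have "\<dots> = emeasure lborel A"
      by (subst nn_integral_lborel_translate) auto
    finally have "emeasure lborel ?A = emeasure lborel A" .
    moreover have "emeasure lborel ?H \<le> emeasure lborel ((?H - ?A) \<union> ?A)"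
      by (rule emeasure_mono) auto
    moreover have "emeasure lborel ((?H - ?A) \<union> ?A) \<le> emeasure lborel (?H - ?A) + emeasure lborel ?A"
      by (rule emeasure_subadditive) auto
    ultimately have "2 * ennreal bm \<le> 4 * (emeasure lborel (?H - ?A) + emeasure lborel A)"
      using emeasure_ball_le_half_ball[of L x] unfolding B_def[symmetric] B
      by (smt (verit) B_def B(1) mult_left_mono mult.assoc numeral_times_numeral order_trans semiring_norm(11) semiring_norm(13) zero_le)
    also have "\<dots> \<le> 4 * emeasure lborel (?H - ?A) + ennreal bm"
      using L(2) unfolding B_def[symmetric] B(1) by (simp add: distrib_left add_left_mono)
    \<comment> \<open>One of the two copies of \<open>bm\<close> cancels because it is
      finite.\<close>
    finally have "ennreal bm \<le> 4 * emeasure lborel (?H - ?A)"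
      by (simp add: mult_2)
    from mult_left_mono[OF this, of "ennreal (a x * (\<psi> x)\<^sup>2)"]
    have "ennreal (a x * (\<psi> x)\<^sup>2) * ennreal bm \<le> 4 * (ennreal (a x * (\<psi> x)\<^sup>2) * emeasure lborel (?H - ?A))"
      by (simp only: mult.left_commute[of _ 4] zero_le)
    also have "ennreal (a x * (\<psi> x)\<^sup>2) * emeasure lborel (?H - ?A)
        = (\<integral>\<^sup>+h. ennreal (a x * (\<psi> x)\<^sup>2) * indicator (?H - ?A) h \<partial>lborel)"
      by (subst nn_integral_cmult_indicator) auto
    also have "\<dots> \<le> (\<integral>\<^sup>+h. ?F x h \<partial>lborel)"
      by (intro nn_integral_mono) (auto simp: indicator_def supp)
    finally show ?thesis
      by (simp add: mult_left_mono)
  qed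
  \<comment> \<open>Inadmissible \<open>x\<close> contribute nothing. For the others
    \<open>a_mono\<close> moves the weight to the point where the gradient is taken; after
    exchanging \<open>x\<close> and \<open>t\<close>, translation invariance turns each inner
    integral into \<open>?D\<close>.\<close>
  have upper: "(\<integral>\<^sup>+x. ?F x h \<partial>lborel) \<le> ennreal (L\<^sup>2) * ?D * indicator B h" for h
  proof (cases "h \<in> B")
    case True
    have "(\<integral>\<^sup>+x. ?F x h \<partial>lborel) \<le> (\<integral>\<^sup>+x. \<integral>\<^sup>+t. ennreal (L\<^sup>2) *
        (ennreal (a (x + t *\<^sub>R h) * (norm (G (x + t *\<^sub>R h)))\<^sup>2) * indicator {0..1::real} t) \<partial>lborel \<partial>lborel)"
    proof (rule nn_integral_mono)
      fix x
      show "?F x h \<le> (\<integral>\<^sup>+t. ennreal (L\<^sup>2) *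
        (ennreal (a (x + t *\<^sub>R h) * (norm (G (x + t *\<^sub>R h)))\<^sup>2) * indicator {0..1::real} t) \<partial>lborel)"
      proof (cases "0 \<le> x \<bullet> h")
        case xh: True
        have "?F x h = ennreal (a x) * ennreal ((\<psi> (x + h) - \<psi> x)\<^sup>2)"
          using True xh a_nonneg by (simp add: ennreal_mult)
        also have "\<dots> \<le> ennreal (a x) *
            (\<integral>\<^sup>+t. ennreal ((norm h)\<^sup>2 * (norm (G (x + t *\<^sub>R h)))\<^sup>2) * indicator {0..1::real} t \<partial>lborel)"
          by (intro mult_left_mono increment_square_le deriv contG) auto
        also have "\<dots> = (\<integral>\<^sup>+t. ennreal (a x) *
            (ennreal ((norm h)\<^sup>2 * (norm (G (x + t *\<^sub>R h)))\<^sup>2) * indicator {0..1::real} t) \<partial>lborel)"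
          by (subst nn_integral_cmult) auto
        also have "\<dots> \<le> (\<integral>\<^sup>+t. ennreal (L\<^sup>2) *
            (ennreal (a (x + t *\<^sub>R h) * (norm (G (x + t *\<^sub>R h)))\<^sup>2) * indicator {0..1::real} t) \<partial>lborel)"
        proof (rule nn_integral_mono)
          fix t :: real
          show "ennreal (a x) * (ennreal ((norm h)\<^sup>2 * (norm (G (x + t *\<^sub>R h)))\<^sup>2) * indicator {0..1} t)
            \<le> ennreal (L\<^sup>2) * (ennreal (a (x + t *\<^sub>R h) * (norm (G (x + t *\<^sub>R h)))\<^sup>2) * indicator {0..1} t)"
          proof (cases "t \<in> {0..1}")
            case t: True
            then have "a x \<le> a (x + t *\<^sub>R h)"
              using xh by (intro a_mono) auto
            moreover have "(norm h)\<^sup>2 \<le> L\<^sup>2"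
              using True by (intro power_mono) (auto simp: B_def)
            ultimately have "a x * ((norm h)\<^sup>2 * (norm (G (x + t *\<^sub>R h)))\<^sup>2)
                \<le> a (x + t *\<^sub>R h) * (L\<^sup>2 * (norm (G (x + t *\<^sub>R h)))\<^sup>2)"
              using a_nonneg by (intro mult_mono mult_right_mono) auto
            then show ?thesis
              using t a_nonneg by (auto simp: ennreal_mult[symmetric] intro!: ennreal_leI simp: mult_ac)
          qed auto
        qed
        finally show ?thesis .
      qed auto
    qed
    also have "\<dots> = (\<integral>\<^sup>+t. \<integral>\<^sup>+x. ennreal (L\<^sup>2) *
        (ennreal (a (x + t *\<^sub>R h) * (norm (G (x + t *\<^sub>R h)))\<^sup>2) * indicator {0..1::real} t) \<partial>lborel \<partial>lborel)"
      by (rule pair_sigma_finite.Fubini'[symmetric, OF pair_sigma_finite.intro[OF sigma_finite_lborel sigma_finite_lborel]]) auto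
    also have "\<dots> = (\<integral>\<^sup>+t. ennreal (L\<^sup>2) * ?D * indicator {0..1::real} t \<partial>lborel)"
    proof (rule nn_integral_cong)
      fix t :: real
      have "(\<integral>\<^sup>+x. ennreal (L\<^sup>2) *
        (ennreal (a (x + t *\<^sub>R h) * (norm (G (x + t *\<^sub>R h)))\<^sup>2) * indicator {0..1::real} t) \<partial>lborel)
        = ennreal (L\<^sup>2) * (\<integral>\<^sup>+x. ennreal (a (x + t *\<^sub>R h) * (norm (G (x + t *\<^sub>R h)))\<^sup>2) \<partial>lborel) * indicator {0..1::real} t"
        by (subst nn_integral_cmult; (subst nn_integral_multc)?) (auto simp: mult.assoc)
      also have "(\<integral>\<^sup>+x. ennreal (a (x + t *\<^sub>R h) * (norm (G (x + t *\<^sub>R h)))\<^sup>2) \<partial>lborel) = ?D"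
        by (rule nn_integral_lborel_translate[where f="\<lambda>x. ennreal (a x * (norm (G x))\<^sup>2)"]) auto
      finally show "(\<integral>\<^sup>+x. ennreal (L\<^sup>2) *
        (ennreal (a (x + t *\<^sub>R h) * (norm (G (x + t *\<^sub>R h)))\<^sup>2) * indicator {0..1::real} t) \<partial>lborel)
        = ennreal (L\<^sup>2) * ?D * indicator {0..1::real} t" .
    qed
    also have "\<dots> = ennreal (L\<^sup>2) * ?D"
      by (subst nn_integral_cmult_indicator) auto
    finally show ?thesis
      using True by simp
  qed simp
  \<comment> \<open>\<open>lower\<close> is integrated over \<open>x\<close> and
    \<open>upper\<close> over \<open>h\<close>; both sides then carry the factor \<open>bm\<close>,
    which is positive and finite and so cancels.\<close>
  have "?E * ennreal bm = (\<integral>\<^sup>+x. ennreal (a x * (\<psi> x)\<^sup>2) * ennreal bm \<partial>lborel)"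
    by (subst nn_integral_multc) auto
  also have "\<dots> \<le> (\<integral>\<^sup>+x. 4 * (\<integral>\<^sup>+h. ?F x h \<partial>lborel) \<partial>lborel)"
    by (intro nn_integral_mono lower)
  also have "\<dots> = 4 * (\<integral>\<^sup>+x. \<integral>\<^sup>+h. ?F x h \<partial>lborel \<partial>lborel)"
    by (subst nn_integral_cmult) (auto simp: indicator_def[of "{h \<in> B. P h}" for P])
  also have "(\<integral>\<^sup>+x. \<integral>\<^sup>+h. ?F x h \<partial>lborel \<partial>lborel) = (\<integral>\<^sup>+h. \<integral>\<^sup>+x. ?F x h \<partial>lborel \<partial>lborel)"
    by (rule pair_sigma_finite.Fubini'[symmetric, OF pair_sigma_finite.intro[OF sigma_finite_lborel sigma_finite_lborel]]) (auto simp: indicator_def[of "{h \<in> B. P h}" for P])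
  also have "\<dots> \<le> (\<integral>\<^sup>+h. ennreal (L\<^sup>2) * ?D * indicator B h \<partial>lborel)"
    by (intro nn_integral_mono upper)
  also have "\<dots> = ennreal (L\<^sup>2) * ?D * ennreal bm"
    by (subst nn_integral_cmult_indicator) (auto simp: B)
  finally have "?E * ennreal bm \<le> (ennreal (4 * L\<^sup>2) * ?D) * ennreal bm"
    by (simp add: mult_left_mono mult.assoc ennreal_mult)
  then show ?thesis
    using B(2) ennreal_mult_le_mult_iff[of "ennreal bm"] by (simp add: mult.commute)
qed

text \<open>Integration by parts without Fubini: the difference quotients have integral 0 by translation
  invariance and converge dominatedly.\<close>

lemma integral_partial_derivative_zero:
  fixes F :: "'a::euclidean_space \<Rightarrow> real" and G :: "'a \<Rightarrow> 'a"
  assumes deriv: "\<And>x. (F has_derivative (\<lambda>h. G x \<bullet> h)) (at x)"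
    and contG: "continuous_on UNIV G"
    and K: "compact K" and F0: "\<And>x. x \<notin> K \<Longrightarrow> F x = 0" and G0: "\<And>x. x \<notin> K \<Longrightarrow> G x = 0"
  shows "(\<integral>x. G x \<bullet> e \<partial>lborel) = 0"
proof -
  have contF: "continuous_on UNIV F"
    using deriv by (auto intro!: has_derivative_continuous_on[where s=UNIV])
  have "bounded (G ` K)"
    by (intro compact_imp_bounded compact_continuous_image K continuous_on_subset[OF contG]) auto
  then obtain M where M: "M > 0" "\<And>x. x \<in> K \<Longrightarrow> norm (G x) \<le> M"
    unfolding bounded_pos by auto
  have GM: "norm (G x) \<le> M" for x
    using M G0[of x] by (cases "x \<in> K") auto
  \<comment> \<open>This Lipschitz bound will dominate the difference quotients uniformly in the
    step size.\<close>
  have lip: "\<bar>F x - F y\<bar> \<le> M * norm (x - y)" for x y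
  proof -
    have "norm (F x - F y) \<le> M * norm (x - y)"
    proof (rule differentiable_bound[of UNIV F "\<lambda>x h. G x \<bullet> h" M])
      show "onorm (\<lambda>h. G z \<bullet> h) \<le> M" for z
        using onorm_inner_left[OF bounded_linear_ident, of "G z"] onorm_inner_right[OF bounded_linear_ident, of "G z"] GM[of z] onorm_id_le
        by (auto intro!: onorm_le order_trans[OF Cauchy_Schwarz_ineq2] mult_right_mono)
    qed (auto intro: has_derivative_at_withinI deriv)
    then show ?thesis by simp
  qed
  obtain R where R: "R > 0" "\<And>x. x \<in> K \<Longrightarrow> norm x \<le> R"
    using compact_imp_bounded[OF K] unfolding bounded_pos by auto
  \<comment> \<open>Difference quotients in direction \<open>e\<close> with step
    \<open>1 / (k + 1)\<close>; \<open>Suc\<close> excludes division by zero and keeps every shift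
    at most \<open>norm e\<close> long.\<close>
  define q where "q = (\<lambda>k x. (F (x + (1 / real (Suc k)) *\<^sub>R e) - F x) * real (Suc k))"
  have [measurable]: "F \<in> borel_measurable borel" "G \<in> borel_measurable borel"
    using contF contG by (auto intro: borel_measurable_continuous_onI)
  have "integrable lborel (\<lambda>x. indicator K x *\<^sub>R F x)"
    by (rule borel_integrable_compact[OF K]) (rule continuous_on_subset[OF contF], simp)
  also have "(\<lambda>x. indicator K x *\<^sub>R F x) = F"
    using F0 by (auto simp: fun_eq_iff indicator_def)
  finally have intF: "integrable lborel F" .
  have shift: "integrable lborel (\<lambda>x. F (x + c)) \<and> (\<integral>x. F (x + c) \<partial>lborel) = (\<integral>x. F x \<partial>lborel)" for c
    using intF integrable_distr_eq[of "(+) c" lborel borel F] integral_distr[of "(+) c" lborel borel F]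
    by (simp add: lborel_distr_plus add.commute)
  have q0: "(\<integral>x. q k x \<partial>lborel) = 0" for k
    unfolding q_def using shift intF by simp
  \<comment> \<open>A shift of length at most \<open>norm e\<close> cannot carry a point outside
    radius \<open>R + norm e\<close> into \<open>K\<close>, so all quotients live on one ball, where
    \<open>M * norm e\<close> bounds them.\<close>
  have "(\<lambda>k. \<integral>x. q k x \<partial>lborel) \<longlonglongrightarrow> (\<integral>x. G x \<bullet> e \<partial>lborel)"
  proof (rule integral_dominated_convergence[where w = "\<lambda>x. indicator (cball 0 (R + norm e)) x *\<^sub>R (M * norm e)"])
    show "integrable lborel (\<lambda>x. indicator (cball (0::'a) (R + norm e)) x *\<^sub>R (M * norm e))"
      by (rule borel_integrable_compact) auto
    show "AE x in lborel. (\<lambda>k. q k x) \<longlonglongrightarrow> G x \<bullet> e"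
    proof (rule AE_I2)
      fix x
      have "((\<lambda>t. F (x + t *\<^sub>R e)) has_real_derivative G x \<bullet> e) (at 0)"
      proof -
        have "((\<lambda>t. x + t *\<^sub>R e) has_derivative (\<lambda>s. s *\<^sub>R e)) (at 0)"
          by (auto intro!: derivative_eq_intros)
        from diff_chain_at[OF this, of F "\<lambda>h. G x \<bullet> h"] deriv[of x] show ?thesis
          by (simp add: o_def has_field_derivative_def mult_commute_abs)
      qed
      then have "((\<lambda>t. (F (x + t *\<^sub>R e) - F x) / t) \<longlongrightarrow> G x \<bullet> e) (at 0)"
        by (simp add: DERIV_def)
      moreover have "filterlim (\<lambda>k. 1 / real (Suc k)) (at 0) sequentially"
        using LIMSEQ_Suc[OF lim_1_over_n] by (auto simp: filterlim_at)
      ultimately have "(\<lambda>k. (F (x + (1 / real (Suc k)) *\<^sub>R e) - F x) / (1 / real (Suc k))) \<longlonglongrightarrow> G x \<bullet> e"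
        by (rule filterlim_compose)
      then show "(\<lambda>k. q k x) \<longlonglongrightarrow> G x \<bullet> e"
        by (simp add: q_def)
    qed
    fix k
    show "AE x in lborel. norm (q k x) \<le> indicator (cball 0 (R + norm e)) x *\<^sub>R (M * norm e)"
    proof (rule AE_I2)
      fix x
      let ?c = "(1 / real (Suc k)) *\<^sub>R e"
      have c: "norm ?c \<le> norm e"
        by (simp add: divide_le_eq mult_le_cancel_left1)
      show "norm (q k x) \<le> indicator (cball 0 (R + norm e)) x *\<^sub>R (M * norm e)"
      proof (cases "x \<in> cball 0 (R + norm e)")
        case True
        have "norm (q k x) \<le> (M * norm ?c) * real (Suc k)"
          using mult_right_mono[OF lip[of "x + ?c" x], of "real (Suc k)"]
          by (simp only: q_def norm_mult real_norm_def abs_of_nat abs_mult add_diff_cancel_left' of_nat_0_le_iff)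
        also have "\<dots> = M * norm e"
          by simp
        finally show ?thesis using True by simp
      next
        case False
        then have "R + norm e < norm x"
          by simp
        moreover have "norm x \<le> norm (x + ?c) + norm ?c"
          by (metis add_diff_cancel_right' norm_triangle_ineq4)
        ultimately have "x \<notin> K" "x + ?c \<notin> K"
          using R(2)[of x] R(2)[of "x + ?c"] c norm_ge_zero[of e] by linarith+
        then have "q k x = 0"
          by (simp only: q_def F0 diff_self mult_zero_left not_False_eq_True)
        then show ?thesis
          using False by simp
      qed
    qed
  qed (auto simp: q_def)
  then show ?thesis
    by (simp add: q0 LIMSEQ_const_iff)
qed

section \<open>The weight\<close>

locale even_convex_potential =
  fixes \<phi> :: "real \<Rightarrow> real"
  assumes even: "\<And>t. \<phi> (- t) = \<phi> t" and convex: "convex_on UNIV \<phi>" and smooth: "smooth_real \<phi>"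
begin

lemma deriv_potential: "(\<phi> has_real_derivative deriv \<phi> t) (at t)"
  using smooth[unfolded smooth_real_def, rule_format, of 0 t]
  by (simp add: DERIV_deriv_iff_real_differentiable)

lemma continuous_deriv_potential: "continuous_on S (deriv \<phi>)"
  using smooth[unfolded smooth_real_def, rule_format, of 1]
  by (auto intro!: continuous_at_imp_continuous_on differentiable_imp_continuous_within)

text \<open>The derivative of an even function is odd. This is what makes the radial extension
  differentiable, and its gradient continuous, at the origin.\<close>

lemma deriv_potential_0: "deriv \<phi> 0 = 0"
proof -
  have "((\<lambda>t. \<phi> (- t)) has_real_derivative deriv \<phi> (- 0) * - 1) (at 0)"
    by (rule DERIV_chain2[OF deriv_potential]) (auto intro!: derivative_eq_intros)
  then have "((\<lambda>t. \<phi> (- t)) has_real_derivative - deriv \<phi> 0) (at 0)"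
    by simp
  then have "- deriv \<phi> 0 = deriv \<phi> 0"
    unfolding even using deriv_potential DERIV_unique by blast
  then show ?thesis by simp
qed

text \<open>The point \<open>s\<close> lies between \<open>- t\<close> and \<open>t\<close>, where
  \<phi> takes equal values, so convexity bounds \<phi> there by that common value.\<close>

lemma potential_mono:
  assumes "0 \<le> s" "s \<le> t" shows "\<phi> s \<le> \<phi> t"
proof (cases "t = 0")
  case False
  \<comment> \<open>Chosen as the solution of
    \<open>(1 - \<theta>) * (- t) + \<theta> * t = s\<close>.\<close>
  define \<theta> where "\<theta> = (t + s) / (2 * t)"
  have t: "0 < t" using assms False by simp
  have "\<phi> ((1 - \<theta>) *\<^sub>R (- t) + \<theta> *\<^sub>R t) \<le> (1 - \<theta>) * \<phi> (- t) + \<theta> * \<phi> t"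
    by (rule convex_onD[OF convex]) (use assms t in \<open>auto simp: \<theta>_def field_simps\<close>)
  moreover have "(1 - \<theta>) *\<^sub>R (- t) + \<theta> *\<^sub>R t = s"
    using t by (simp add: \<theta>_def field_simps)
  ultimately show ?thesis
    by (simp add: even algebra_simps)
qed (use assms in auto)

text \<open>The gradient of the radial extension of \<phi>. At the origin the formula evaluates to
  0, which is the correct gradient because \<open>deriv \<phi> 0 = 0\<close>.\<close>

definition drift :: "'a::euclidean_space \<Rightarrow> 'a" where
  "drift x = (deriv \<phi> (norm x) / norm x) *\<^sub>R x"

lemma norm_drift: "norm (drift x) = \<bar>deriv \<phi> (norm x)\<bar>"
  by (cases "x = 0") (auto simp: drift_def deriv_potential_0)

text \<open>Away from the origin this is the chain rule. At the origin the norm is not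
  differentiable, but \<open>deriv \<phi> 0 = 0\<close> makes the increment of \<phi> of smaller
  order than the norm.\<close>

lemma has_derivative_radial_potential:
  fixes x :: "'a::euclidean_space"
  shows "((\<lambda>x. \<phi> (norm x)) has_derivative (\<lambda>h. drift x \<bullet> h)) (at x)"
proof (cases "x = 0")
  case False
  have "(norm has_derivative (\<lambda>h. (x \<bullet> h) / norm x)) (at x)"
    using has_derivative_norm[OF False] by (simp add: sgn_div_norm inner_commute divide_inverse_commute)
  from diff_chain_at[OF this deriv_potential[unfolded has_field_derivative_def]]
  show ?thesis
    by (simp add: o_def drift_def)
next
  case True
  have "(\<phi> has_derivative (\<lambda>h. 0)) (at 0)"
    using deriv_potential[of 0] unfolding has_field_derivative_def deriv_potential_0 mult_zero_left[abs_def] .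
  then have *: "\<exists>d>0. \<forall>y. \<bar>y\<bar> < d \<longrightarrow> \<bar>\<phi> y - \<phi> 0\<bar> \<le> e * \<bar>y\<bar>" if "e > 0" for e
    using that unfolding has_derivative_at_alt by simp
  show ?thesis
    unfolding has_derivative_at_alt True
  proof (intro conjI allI impI)
    fix e :: real assume "0 < e"
    from *[OF this] obtain d where d: "d > 0" "\<And>y. \<bar>y\<bar> < d \<Longrightarrow> \<bar>\<phi> y - \<phi> 0\<bar> \<le> e * \<bar>y\<bar>"
      by blast
    have "\<bar>\<phi> (norm y) - \<phi> 0\<bar> \<le> e * norm y" if "norm y < d" for y :: 'a
      using d(2)[of "norm y"] that by simp
    with d(1) show "\<exists>d>0. \<forall>y::'a. norm (y - 0) < d \<longrightarrow>
        norm (\<phi> (norm y) - \<phi> (norm 0) - drift 0 \<bullet> (y - 0)) \<le> e * norm (y - 0)"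
      by (intro exI[of _ d]) (auto simp: drift_def)
  qed (auto intro: bounded_linear_inner_right)
qed

text \<open>Only the origin needs an argument: there the length of the drift is the absolute value
  of \<open>deriv \<phi>\<close> at the norm, which tends to 0.\<close>

lemma continuous_drift: "continuous_on S (drift :: 'a::euclidean_space \<Rightarrow> 'a)"
proof (rule continuous_at_imp_continuous_on, rule ballI)
  fix x :: 'a
  show "isCont drift x"
  proof (cases "x = 0")
    case False
    have "isCont (\<lambda>x. (deriv \<phi> (norm x) / norm x) *\<^sub>R x) x"
      using False continuous_deriv_potential[of UNIV]
      by (intro continuous_intros isCont_o2[of _ norm "deriv \<phi>"]) (auto simp: continuous_on_eq_continuous_at)
    then show ?thesis by (simp add: drift_def[abs_def])
  next
    case True
    have "isCont (\<lambda>x::'a. \<bar>deriv \<phi> (norm x)\<bar>) 0"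
      using continuous_deriv_potential[of UNIV]
      by (intro continuous_intros isCont_o2[of _ norm "deriv \<phi>"]) (auto simp: continuous_on_eq_continuous_at)
    then have "((\<lambda>x::'a. norm (drift x)) \<longlongrightarrow> 0) (at 0)"
      unfolding norm_drift isCont_def by (simp add: deriv_potential_0)
    then have "(drift \<longlongrightarrow> (0::'a)) (at 0)"
      by (rule tendsto_norm_zero_cancel)
    moreover have "drift 0 = (0::'a)"
      by (simp add: drift_def)
    ultimately show ?thesis
      by (simp add: True isCont_def)
  qed
qed

definition weight :: "'a::euclidean_space \<Rightarrow> real" where
  "weight x = exp (\<phi> (norm x))"

lemma has_derivative_weight: "(weight has_derivative (\<lambda>h. (weight x *\<^sub>R drift x) \<bullet> h)) (at x)"
proof -
  have "((\<lambda>x. exp (\<phi> (norm x))) has_derivative (\<lambda>h. exp (\<phi> (norm x)) * (drift x \<bullet> h))) (at x)"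
    using has_derivative_exp[OF has_derivative_radial_potential[of x]] by (simp add: mult.commute)
  then show ?thesis
    by (simp add: weight_def[abs_def])
qed

lemma continuous_weight: "continuous_on S weight"
  by (rule has_derivative_continuous_on[OF has_derivative_at_withinI[OF has_derivative_weight]])

lemma weight_measurable [measurable]: "weight \<in> borel_measurable borel"
  by (intro borel_measurable_continuous_onI continuous_weight)

lemma weight_nonneg: "0 \<le> weight x"
  by (simp add: weight_def)

text \<open>A step making no obtuse angle with the position vector does not decrease the distance
  from the origin, and \<phi> is increasing in that distance. This supplies \<open>a_mono\<close> in
  \<open>weighted_poincare\<close>.\<close>

lemma weight_mono:
  assumes "0 \<le> x \<bullet> h" shows "weight x \<le> weight (x + h)"
proof -
  have "(norm x)\<^sup>2 \<le> (norm (x + h))\<^sup>2"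
    using assms by (simp add: power2_norm_eq_inner inner_add inner_commute)
  then have "norm x \<le> norm (x + h)"
    by (rule power2_le_imp_le) simp
  then show ?thesis
    by (simp add: weight_def potential_mono)
qed

lemma weighted_measure_eq: "weighted_measure \<phi> = density lborel (\<lambda>x. ennreal (weight x))"
  by (simp add: weighted_measure_def weight_def)

lemma sets_weighted_measure [measurable_cong, simp]: "sets (weighted_measure \<phi>) = sets borel"
  by (simp add: weighted_measure_def)

lemma space_weighted_measure [simp]: "space (weighted_measure \<phi>) = UNIV"
  by (simp add: weighted_measure_def)

lemma integral_weighted_measure:
  fixes f :: "real^'n \<Rightarrow> real"
  assumes "f \<in> borel_measurable borel"
  shows "(\<integral>x. f x \<partial>weighted_measure \<phi>) = (\<integral>x. weight x * f x \<partial>lborel)"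
  unfolding weighted_measure_eq using assms
  by (subst integral_density) (simp_all add: weight_nonneg)

lemma integrable_weighted_measure:
  fixes f :: "real^'n \<Rightarrow> real"
  assumes "f \<in> borel_measurable borel"
  shows "integrable (weighted_measure \<phi>) f \<longleftrightarrow> integrable lborel (\<lambda>x. weight x * f x)"
  unfolding weighted_measure_eq using assms
  by (subst integrable_density) (simp_all add: weight_nonneg)

lemma integrable_compact_support:
  fixes f :: "real^'n \<Rightarrow> real"
  assumes f: "continuous_on UNIV f" and K: "compact K" "\<And>x. x \<notin> K \<Longrightarrow> f x = 0"
  shows "integrable (weighted_measure \<phi>) f"
proof -
  have "integrable lborel (\<lambda>x. indicator K x *\<^sub>R (weight x * f x))"
    by (intro borel_integrable_compact K continuous_intros continuous_weight continuous_on_subset[OF f]) simp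
  also have "(\<lambda>x. indicator K x *\<^sub>R (weight x * f x)) = (\<lambda>x. weight x * f x)"
    using K(2) by (auto simp: fun_eq_iff indicator_def)
  finally show ?thesis
    using f by (simp add: integrable_weighted_measure borel_measurable_continuous_onI)
qed

lemma emeasure_weighted_measure_bounded:
  fixes A :: "(real^'n) set"
  assumes "bounded A" "A \<in> sets borel"
  shows "emeasure (weighted_measure \<phi>) A < \<infinity>"
proof -
  have "compact (closure A)" using assms by simp
  then have "bounded (weight ` closure A)"
    by (intro compact_imp_bounded compact_continuous_image continuous_weight)
  then obtain M where M: "\<And>x. x \<in> closure A \<Longrightarrow> norm (weight x) \<le> M"
    unfolding bounded_pos by auto
  have M': "weight x \<le> M" if "x \<in> A" for x
    using M[of x] that closure_subset[of A] by auto
  have "emeasure (weighted_measure \<phi>) A = (\<integral>\<^sup>+x. ennreal (weight x) * indicator A x \<partial>lborel)"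
    using assms by (simp add: weighted_measure_eq emeasure_density)
  also have "\<dots> \<le> (\<integral>\<^sup>+x. ennreal M * indicator A x \<partial>lborel)"
    by (intro nn_integral_mono) (auto simp: indicator_def M' intro!: ennreal_leI)
  also have "\<dots> = ennreal M * emeasure lborel A"
    using assms by (simp add: nn_integral_cmult_indicator)
  also have "\<dots> < \<infinity>"
    using emeasure_bounded_finite[OF assms(1)] by (simp add: ennreal_mult_less_top)
  finally show ?thesis .
qed

text \<open>The weight is smallest at the origin. Thus the weighted measure of a domain controls its
  Lebesgue measure, which in turn fixes an admissible radius \<open>L\<close>.\<close>

lemma emeasure_weighted_measure_ge:
  fixes A :: "(real^'n) set"
  assumes "A \<in> sets borel"
  shows "ennreal (exp (\<phi> 0)) * emeasure lborel A \<le> emeasure (weighted_measure \<phi>) A"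
proof -
  have "ennreal (exp (\<phi> 0)) * emeasure lborel A = (\<integral>\<^sup>+x. ennreal (exp (\<phi> 0)) * indicator A x \<partial>lborel)"
    using assms by (simp add: nn_integral_cmult_indicator)
  also have "\<dots> \<le> (\<integral>\<^sup>+x. ennreal (weight x) * indicator A x \<partial>lborel)"
    by (intro nn_integral_mono mult_right_mono ennreal_leI) (auto simp: weight_def potential_mono)
  also have "\<dots> = emeasure (weighted_measure \<phi>) A"
    using assms by (simp add: weighted_measure_eq emeasure_density)
  finally show ?thesis .
qed

end

section \<open>Test functions\<close>

definition gradient :: "(real^'n \<Rightarrow> real) \<Rightarrow> real^'n \<Rightarrow> real^'n" where
  "gradient f x = (\<chi> i. partial_deriv i f x)"

lemma norm_gradient_power2: "(norm (gradient f x))\<^sup>2 = (\<Sum>i\<in>UNIV. (partial_deriv i f x)\<^sup>2)"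
  unfolding power2_norm_eq_inner inner_vec_def gradient_def by (simp add: power2_eq_square)

lemma partial_deriv_eq:
  assumes "(f has_derivative D) (at x)"
  shows "partial_deriv i f x = D (axis i 1)"
  using frechet_derivative_at[OF assms] by (simp add: partial_deriv_def)

lemma has_derivative_gradient:
  fixes f :: "real^'n \<Rightarrow> real"
  assumes "f differentiable at x"
  shows "(f has_derivative (\<lambda>h. gradient f x \<bullet> h)) (at x)"
proof -
  obtain D where D: "(f has_derivative D) (at x)"
    using assms by (auto simp: differentiable_def)
  then interpret linear D
    by (rule has_derivative_linear)
  have "D h = gradient f x \<bullet> h" for h
  proof -
    have "D h = D (\<Sum>i\<in>UNIV. (h $ i) *\<^sub>R axis i 1)"
      using basis_expansion[of h] by (simp add: scalar_mult_eq_scaleR)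
    also have "\<dots> = gradient f x \<bullet> h"
      by (simp add: sum scale inner_vec_def gradient_def partial_deriv_eq[OF D] mult.commute)
    finally show ?thesis .
  qed
  then show ?thesis
    using D by (metis ext)
qed

lemma partial_deriv_eq_0:
  fixes f :: "real^'n \<Rightarrow> real"
  assumes "open U" "x \<in> U" "\<And>y. y \<in> U \<Longrightarrow> f y = 0"
  shows "partial_deriv i f x = 0"
proof -
  have "(f has_derivative (\<lambda>_. 0)) (at x)"
    by (rule has_derivative_transform_within_open[OF has_derivative_const[of 0] assms(1,2)])
      (simp add: assms(3))
  then show ?thesis
    by (simp add: partial_deriv_eq)
qed

lemma smooth_on_partial_deriv: "smooth_on S f \<Longrightarrow> smooth_on S (partial_deriv i f)"
  unfolding smooth_on_def
proof (intro allI ballI)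
  fix "is" x
  assume "\<forall>is. \<forall>x\<in>S. foldr partial_deriv is f differentiable at x" "x \<in> S"
  \<comment> \<open>\<open>foldr\<close> applies the last entry of the list first, so appending
    \<open>i\<close> puts the new derivative innermost.\<close>
  then have "foldr partial_deriv (is @ [i]) f differentiable at x"
    by blast
  then show "foldr partial_deriv is (partial_deriv i f) differentiable at x"
    by simp
qed

lemma smooth_on_differentiable: "smooth_on S f \<Longrightarrow> x \<in> S \<Longrightarrow> f differentiable at x"
  unfolding smooth_on_def by (drule spec[of _ "[]"]) simp

lemma smooth_on_continuous: "smooth_on UNIV f \<Longrightarrow> continuous_on S f"
  by (intro continuous_at_imp_continuous_on ballI differentiable_imp_continuous_within smooth_on_differentiable[OF _ UNIV_I])

lemma continuous_gradient: "smooth_on UNIV f \<Longrightarrow> continuous_on S (gradient f)"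
  unfolding gradient_def by (intro continuous_on_vec_lambda smooth_on_continuous smooth_on_partial_deriv)

text \<open>A derivative vanishes on the open complement of the support, so differentiation cannot
  enlarge the support.\<close>

lemma test_function_partial_deriv:
  assumes "\<psi> \<in> test_functions \<Omega>"
  shows "partial_deriv i \<psi> \<in> test_functions \<Omega>"
proof -
  have "{x. partial_deriv i \<psi> x \<noteq> 0} \<subseteq> closure {x. \<psi> x \<noteq> 0}"
  proof (rule subsetI, rule ccontr)
    fix x assume x: "x \<in> {x. partial_deriv i \<psi> x \<noteq> 0}" "x \<notin> closure {x. \<psi> x \<noteq> 0}"
    have "partial_deriv i \<psi> x = 0"
      by (rule partial_deriv_eq_0[of "- closure {x. \<psi> x \<noteq> 0}"])
        (use x closure_subset[of "{x. \<psi> x \<noteq> 0}"] in auto)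
    with x show False by simp
  qed
  then have sub: "closure {x. partial_deriv i \<psi> x \<noteq> 0} \<subseteq> closure {x. \<psi> x \<noteq> 0}"
    by (metis closure_closure closure_mono)
  then have "compact (closure {x. \<psi> x \<noteq> 0}) \<Longrightarrow> compact (closure {x. partial_deriv i \<psi> x \<noteq> 0})"
    using compact_Int_closed[of "closure {x. \<psi> x \<noteq> 0}" "closure {x. partial_deriv i \<psi> x \<noteq> 0}"]
    by (simp add: inf.absorb2)
  then show ?thesis
    using assms sub unfolding test_functions_def by (auto intro: smooth_on_partial_deriv)
qed

lemma test_function_smooth: "\<psi> \<in> test_functions \<Omega> \<Longrightarrow> smooth_on UNIV \<psi>"
  by (simp add: test_functions_def)

lemma test_function_eq_0: "\<psi> \<in> test_functions \<Omega> \<Longrightarrow> x \<notin> \<Omega> \<Longrightarrow> \<psi> x = 0"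
  using closure_subset[of "{x. \<psi> x \<noteq> 0}"] by (auto simp: test_functions_def)

text \<open>One compact set serves the function and its first and second partial derivatives at
  once, as needed for integrability and for integration by parts.\<close>

lemma test_function_support:
  assumes "\<psi> \<in> test_functions \<Omega>"
  obtains K where "compact K" "\<And>x. x \<notin> K \<Longrightarrow> \<psi> x = 0"
    "\<And>x i. x \<notin> K \<Longrightarrow> partial_deriv i \<psi> x = 0"
    "\<And>x i j. x \<notin> K \<Longrightarrow> partial_deriv j (partial_deriv i \<psi>) x = 0"
proof -
  define K where "K = closure {x. \<psi> x \<noteq> 0}"
  have 0: "\<psi> x = 0" if "x \<notin> K" for x
    using that closure_subset[of "{x. \<psi> x \<noteq> 0}"] by (auto simp: K_def)
  have "compact K"
    using assms unfolding K_def test_functions_def by blast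
  then have K: "open (- K)"
    by (simp add: compact_imp_closed open_Compl)
  have 1: "partial_deriv i \<psi> x = 0" if "x \<notin> K" for x i
    by (rule partial_deriv_eq_0[OF K]) (simp_all add: that 0)
  have 2: "partial_deriv j (partial_deriv i \<psi>) x = 0" if "x \<notin> K" for x i j
    by (rule partial_deriv_eq_0[OF K]) (simp_all add: that 1)
  show ?thesis
    by (rule that[OF \<open>compact K\<close> 0 1 2])
qed

section \<open>Integration by parts for the drift Laplacian, and the estimate for test
  functions\<close>

context even_convex_potential
begin

text \<open>Built from classical derivatives, so that for test functions no choice of a weak
  derivative enters.\<close>

definition classical_drift_laplacian :: "(real^'n \<Rightarrow> real) \<Rightarrow> real^'n \<Rightarrow> real" where
  "classical_drift_laplacian \<psi> x =
     (\<Sum>i\<in>UNIV. partial_deriv i (partial_deriv i \<psi>) x) + (\<Sum>i\<in>UNIV. drift x $ i * partial_deriv i \<psi> x)"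

lemma continuous_classical_drift_laplacian:
  "smooth_on UNIV \<psi> \<Longrightarrow> continuous_on S (classical_drift_laplacian \<psi>)"
  unfolding classical_drift_laplacian_def
  by (intro continuous_intros continuous_drift smooth_on_continuous smooth_on_partial_deriv)

text \<open>For each \<open>i\<close>, the partial derivative in direction \<open>i\<close> of
  \<open>weight * \<psi> * partial_deriv i \<psi>\<close> integrates to 0. Differentiating the
  weight produces exactly the drift term, and summing over \<open>i\<close> gives the
  identity.\<close>

lemma dirichlet_energy_eq:
  fixes \<psi> :: "real^'n \<Rightarrow> real"
  assumes \<psi>: "\<psi> \<in> test_functions \<Omega>"
  shows "(\<integral>x. (norm (gradient \<psi> x))\<^sup>2 \<partial>weighted_measure \<phi>)
    = - (\<integral>x. \<psi> x * classical_drift_laplacian \<psi> x \<partial>weighted_measure \<phi>)"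
proof -
  obtain K where K: "compact K" "\<And>x. x \<notin> K \<Longrightarrow> \<psi> x = 0"
    "\<And>x i. x \<notin> K \<Longrightarrow> partial_deriv i \<psi> x = 0"
    "\<And>x i j. x \<notin> K \<Longrightarrow> partial_deriv j (partial_deriv i \<psi>) x = 0"
    using test_function_support[OF \<psi>] by metis
  note sm = test_function_smooth[OF \<psi>]
  note cont = smooth_on_continuous[OF sm] smooth_on_continuous[OF smooth_on_partial_deriv[OF sm]]
    smooth_on_continuous[OF smooth_on_partial_deriv[OF smooth_on_partial_deriv[OF sm]]]
    continuous_gradient[OF sm] continuous_gradient[OF smooth_on_partial_deriv[OF sm]]
    continuous_weight continuous_drift
  \<comment> \<open>\<open>V i\<close> is the full gradient of
    \<open>weight * \<psi> * partial_deriv i \<psi>\<close>; its component \<open>i\<close> is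
    \<open>weight * T i\<close>, with \<open>T i\<close> the integrand against the weighted
    measure.\<close>
  define V where "V = (\<lambda>i x. (weight x * \<psi> x * partial_deriv i \<psi> x) *\<^sub>R drift x
      + (weight x * partial_deriv i \<psi> x) *\<^sub>R gradient \<psi> x
      + (weight x * \<psi> x) *\<^sub>R gradient (partial_deriv i \<psi>) x)"
  define T where "T = (\<lambda>i x. \<psi> x * partial_deriv i \<psi> x * drift x $ i + (partial_deriv i \<psi> x)\<^sup>2
      + \<psi> x * partial_deriv i (partial_deriv i \<psi>) x)"
  have VT: "V i x \<bullet> axis i 1 = weight x * T i x" for i x
    by (simp add: V_def T_def inner_axis gradient_def algebra_simps power2_eq_square)
  have contT: "continuous_on UNIV (T i)" for i
    unfolding T_def by (intro continuous_intros cont)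
  have "(\<integral>x. V i x \<bullet> axis i 1 \<partial>lborel) = 0" for i
  proof (rule integral_partial_derivative_zero[where F="\<lambda>x. weight x * (\<psi> x * partial_deriv i \<psi> x)"])
    fix x
    have "\<psi> differentiable at x" "partial_deriv i \<psi> differentiable at x"
      by (auto intro: smooth_on_differentiable smooth_on_partial_deriv sm)
    note d = this[THEN has_derivative_gradient]
    show "((\<lambda>x. weight x * (\<psi> x * partial_deriv i \<psi> x)) has_derivative (\<lambda>h. V i x \<bullet> h)) (at x)"
      by (rule has_derivative_eq_rhs[OF has_derivative_mult[OF has_derivative_weight has_derivative_mult[OF d]]])
        (auto simp: V_def algebra_simps)
    show "continuous_on UNIV (V i)"
      unfolding V_def by (intro continuous_intros cont)
  qed (use K in \<open>auto simp: V_def\<close>)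
  then have T0: "(\<integral>x. T i x \<partial>weighted_measure \<phi>) = 0" for i
    by (simp add: VT integral_weighted_measure borel_measurable_continuous_onI contT)
  have intT: "integrable (weighted_measure \<phi>) (T i)" for i
    by (rule integrable_compact_support[OF contT K(1)]) (simp add: T_def K)
  have int1: "integrable (weighted_measure \<phi>) (\<lambda>x. (norm (gradient \<psi> x))\<^sup>2)"
    by (rule integrable_compact_support[OF _ K(1)]) (intro continuous_intros cont, simp add: gradient_def K vec_eq_iff)
  have int2: "integrable (weighted_measure \<phi>) (\<lambda>x. \<psi> x * classical_drift_laplacian \<psi> x)"
    by (rule integrable_compact_support[OF _ K(1)])
      (intro continuous_intros cont continuous_classical_drift_laplacian sm, simp add: K)
  have "(\<integral>x. (norm (gradient \<psi> x))\<^sup>2 \<partial>weighted_measure \<phi>)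
      + (\<integral>x. \<psi> x * classical_drift_laplacian \<psi> x \<partial>weighted_measure \<phi>)
      = (\<integral>x. (norm (gradient \<psi> x))\<^sup>2 + \<psi> x * classical_drift_laplacian \<psi> x \<partial>weighted_measure \<phi>)"
    using int1 int2 by simp
  also have "\<dots> = (\<integral>x. (\<Sum>i\<in>UNIV. T i x) \<partial>weighted_measure \<phi>)"
    by (rule Bochner_Integration.integral_cong[OF refl])
      (simp add: norm_gradient_power2 T_def classical_drift_laplacian_def
        sum.distrib distrib_left sum_distrib_left mult_ac)
  also have "\<dots> = 0"
    using intT by (simp add: T0)
  finally show ?thesis
    by simp
qed

text \<open>Write \<open>E\<close>, \<open>D\<close>, \<open>S\<close> for the weighted integrals of
  the squares of \<psi>, its gradient and its drift Laplacian, and \<kappa> for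
  \<open>4 * L^2\<close>. The Poincare inequality gives \<open>E \<le> \<kappa> * D\<close>;
  integration by parts with Young's inequality gives
  \<open>2 * \<kappa> * D \<le> E + \<kappa>^2 * S\<close>. Together they yield
  \<open>E \<le> \<kappa>^2 * S\<close>.\<close>

lemma test_function_estimate:
  fixes \<psi> :: "real^'n \<Rightarrow> real"
  assumes \<psi>: "\<psi> \<in> test_functions \<Omega>" and \<Omega>: "\<Omega> \<in> sets borel"
    and L: "0 < L" "4 * emeasure lborel \<Omega> \<le> emeasure lborel (ball (0::real^'n) L)"
  shows "(\<integral>x. (\<psi> x)\<^sup>2 \<partial>weighted_measure \<phi>)
    \<le> (4 * L\<^sup>2)\<^sup>2 * (\<integral>x. (classical_drift_laplacian \<psi> x)\<^sup>2 \<partial>weighted_measure \<phi>)"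
proof -
  obtain K where K: "compact K" "\<And>x. x \<notin> K \<Longrightarrow> \<psi> x = 0"
    "\<And>x i. x \<notin> K \<Longrightarrow> partial_deriv i \<psi> x = 0"
    "\<And>x i j. x \<notin> K \<Longrightarrow> partial_deriv j (partial_deriv i \<psi>) x = 0"
    using test_function_support[OF \<psi>] by metis
  note sm = test_function_smooth[OF \<psi>]
  note cont = smooth_on_continuous[OF sm] continuous_gradient[OF sm] continuous_classical_drift_laplacian[OF sm]
  let ?W = "weighted_measure \<phi> :: (real^'n) measure"
  let ?\<kappa> = "4 * L\<^sup>2"
  have L0: "classical_drift_laplacian \<psi> x = 0" if "x \<notin> K" for x
    using K that by (simp add: classical_drift_laplacian_def)
  have G0: "gradient \<psi> x = 0" if "x \<notin> K" for x
    using K that by (simp add: gradient_def vec_eq_iff)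
  have int: "integrable ?W (\<lambda>x. (\<psi> x)\<^sup>2)" "integrable ?W (\<lambda>x. (norm (gradient \<psi> x))\<^sup>2)"
     "integrable ?W (\<lambda>x. (classical_drift_laplacian \<psi> x)\<^sup>2)"
     "integrable ?W (\<lambda>x. \<psi> x * classical_drift_laplacian \<psi> x)"
    by (rule integrable_compact_support[OF _ K(1)], intro continuous_intros cont, simp add: K L0 G0)+
  define E where "E = (\<integral>x. (\<psi> x)\<^sup>2 \<partial>?W)"
  define D where "D = (\<integral>x. (norm (gradient \<psi> x))\<^sup>2 \<partial>?W)"
  define S where "S = (\<integral>x. (classical_drift_laplacian \<psi> x)\<^sup>2 \<partial>?W)"
  \<comment> \<open>Translates the nonnegative Lebesgue integrals of
    \<open>weighted_poincare\<close> into real integrals against the weighted measure.\<close>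
  have nn: "(\<integral>\<^sup>+x. ennreal (weight x * f x) \<partial>lborel) = ennreal (\<integral>x. f x \<partial>?W)"
    if "integrable ?W f" "\<And>x. 0 \<le> f x" for f
  proof -
    have [measurable]: "f \<in> borel_measurable borel"
      using borel_measurable_integrable[OF that(1)] by simp
    show ?thesis
      using that by (subst nn_integral_eq_integral[symmetric])
        (simp_all add: weighted_measure_eq nn_integral_density ennreal_mult weight_nonneg)
  qed
  have "(\<integral>\<^sup>+x. ennreal (weight x * (\<psi> x)\<^sup>2) \<partial>lborel)
    \<le> ennreal ?\<kappa> * (\<integral>\<^sup>+x. ennreal (weight x * (norm (gradient \<psi> x))\<^sup>2) \<partial>lborel)"
  proof (rule weighted_poincare)
    show "(\<psi> has_derivative (\<lambda>h. gradient \<psi> x \<bullet> h)) (at x)" for x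
      by (intro has_derivative_gradient smooth_on_differentiable[OF sm]) simp
    show "\<psi> x = 0" if "x \<notin> \<Omega>" for x
      by (rule test_function_eq_0[OF \<psi> that])
  qed (use L \<Omega> in \<open>simp_all add: cont weight_nonneg weight_mono\<close>)
  then have ED: "E \<le> ?\<kappa> * D"
    unfolding nn[OF int(1), simplified] nn[OF int(2), simplified] E_def[symmetric] D_def[symmetric]
    using L(1) by (simp add: ennreal_mult[symmetric] D_def)
  have "2 * ?\<kappa> * D = (\<integral>x. - (2 * ?\<kappa>) * (\<psi> x * classical_drift_laplacian \<psi> x) \<partial>?W)"
    using dirichlet_energy_eq[OF \<psi>] by (simp add: D_def)
  also have "\<dots> \<le> (\<integral>x. (\<psi> x)\<^sup>2 + ?\<kappa>\<^sup>2 * (classical_drift_laplacian \<psi> x)\<^sup>2 \<partial>?W)"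
  proof (rule integral_mono)
    fix x
    show "- (2 * ?\<kappa>) * (\<psi> x * classical_drift_laplacian \<psi> x) \<le> (\<psi> x)\<^sup>2 + ?\<kappa>\<^sup>2 * (classical_drift_laplacian \<psi> x)\<^sup>2"
      using zero_le_power2[of "\<psi> x + ?\<kappa> * classical_drift_laplacian \<psi> x"]
      by (simp add: power2_sum algebra_simps)
  qed (intro Bochner_Integration.integrable_add integrable_mult_right int)+
  also have "\<dots> = E + ?\<kappa>\<^sup>2 * S"
    using int by (simp add: E_def S_def)
  finally show ?thesis
    using ED by (simp add: E_def[symmetric] S_def[symmetric])
qed

end

section \<open>Lower bound for the clamped plate eigenvalues\<close>

definition square_integrable :: "'a measure \<Rightarrow> ('a \<Rightarrow> real) \<Rightarrow> bool" where
  "square_integrable M f \<longleftrightarrow> f \<in> borel_measurable M \<and> integrable M (\<lambda>x. (f x)\<^sup>2)"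

lemma square_integrable_scale_bounded:
  assumes f: "square_integrable M f" and [measurable]: "g \<in> borel_measurable M" and B: "\<And>x. \<bar>g x\<bar> \<le> B"
  shows "square_integrable M (\<lambda>x. g x * f x)"
proof -
  have [measurable]: "f \<in> borel_measurable M"
    using f by (simp add: square_integrable_def)
  have "integrable M (\<lambda>x. (g x * f x)\<^sup>2)"
  proof (rule Bochner_Integration.integrable_bound)
    show "integrable M (\<lambda>x. B\<^sup>2 * (f x)\<^sup>2)"
      using f by (simp add: square_integrable_def)
    have "(g x)\<^sup>2 \<le> B\<^sup>2" for x
      using B[of x] by (rule power2_le_iff_abs_le[THEN iffD2, rotated]) (use B[of x] in linarith)
    then show "AE x in M. norm ((g x * f x)\<^sup>2) \<le> norm (B\<^sup>2 * (f x)\<^sup>2)"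
      by (simp add: power_mult_distrib mult_right_mono)
  qed measurable
  then show ?thesis
    by (simp add: square_integrable_def)
qed

text \<open>The dominating function \<open>2 * f^2 + 2 * g^2\<close> exceeds
  \<open>(f + g)^2\<close> by \<open>(f - g)^2\<close>.\<close>

lemma square_integrable_add:
  assumes f: "square_integrable M f" and g: "square_integrable M g"
  shows "square_integrable M (\<lambda>x. f x + g x)"
proof -
  have [measurable]: "f \<in> borel_measurable M" "g \<in> borel_measurable M"
    using f g by (simp_all add: square_integrable_def)
  have "integrable M (\<lambda>x. (f x + g x)\<^sup>2)"
  proof (rule Bochner_Integration.integrable_bound)
    show "integrable M (\<lambda>x. 2 * (f x)\<^sup>2 + 2 * (g x)\<^sup>2)"
      using f g by (simp add: square_integrable_def)
    show "AE x in M. norm ((f x + g x)\<^sup>2) \<le> norm (2 * (f x)\<^sup>2 + 2 * (g x)\<^sup>2)"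
    proof (rule AE_I2)
      fix x
      show "norm ((f x + g x)\<^sup>2) \<le> norm (2 * (f x)\<^sup>2 + 2 * (g x)\<^sup>2)"
        unfolding real_norm_def abs_power2
        by (rule order_trans[OF _ abs_ge_self])
          (use zero_le_power2[of "f x - g x"] in \<open>simp add: power2_sum power2_diff\<close>)
    qed
  qed measurable
  then show ?thesis
    by (simp add: square_integrable_def)
qed

lemma square_integrable_diff:
  assumes f: "square_integrable M f" and g: "square_integrable M g"
  shows "square_integrable M (\<lambda>x. f x - g x)"
  using square_integrable_add[OF f square_integrable_scale_bounded[OF g, of "\<lambda>_. -1" 1]] by simp

lemma square_integrable_sum:
  assumes "\<And>i. i \<in> I \<Longrightarrow> square_integrable M (f i)"
  shows "square_integrable M (\<lambda>x. \<Sum>i\<in>I. f i x)"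
  using assms
proof (induction I rule: infinite_finite_induct)
  case (insert i I)
  then show ?case
    by (simp add: square_integrable_add)
qed (simp_all add: square_integrable_def)

section \<open>Extension from test functions to the Sobolev space, and the eigenvalue bound\<close>

context even_convex_potential
begin

lemma measurable_weighted_measure [simp]:
  "measurable (weighted_measure \<phi> :: (real^'n) measure) N = measurable borel N"
  by (rule measurable_cong_sets) simp_all

lemma weighted_L2_square_integrable:
  fixes f :: "real^'n \<Rightarrow> real"
  assumes "f \<in> weighted_L2 \<phi> \<Omega>"
  shows "square_integrable (weighted_measure \<phi>) (\<lambda>x. indicator \<Omega> x * f x)"
proof -
  have "(indicator \<Omega> x * f x)\<^sup>2 = indicator \<Omega> x * (f x)\<^sup>2" for x
    by (simp add: indicator_def)
  moreover have "(\<lambda>x. indicator \<Omega> x * f x) \<in> borel_measurable (weighted_measure \<phi>)"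
    using assms by (simp add: weighted_L2_def set_borel_measurable_def)
  ultimately show ?thesis
    using assms by (simp add: square_integrable_def weighted_L2_def set_integrable_def)
qed

lemma test_function_square_integrable:
  assumes "\<psi> \<in> test_functions \<Omega>"
  shows "square_integrable (weighted_measure \<phi>) \<psi>"
proof -
  obtain K where K: "compact K" "\<And>x. x \<notin> K \<Longrightarrow> \<psi> x = 0"
    using test_function_support[OF assms] by metis
  have "continuous_on UNIV \<psi>"
    by (rule smooth_on_continuous[OF test_function_smooth[OF assms]])
  moreover have "integrable (weighted_measure \<phi>) (\<lambda>x. (\<psi> x)\<^sup>2)"
    by (rule integrable_compact_support[OF _ K(1)]) (simp_all add: K continuous_on_power calculation)
  ultimately show ?thesis
    by (simp add: square_integrable_def borel_measurable_continuous_onI)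
qed

text \<open>The estimate for test functions passes to limits in the Sobolev norm. The extra factor 4
  comes from using \<open>(p + q)^2 \<le> 2 * p^2 + 2 * q^2\<close> twice, once for \<open>u\<close>
  and once for its drift Laplacian; the loss is harmless, since the constant still depends on
  \<open>L\<close> alone.\<close>

lemma clamped_plate_estimate:
  fixes u :: "real^'n \<Rightarrow> real"
  assumes u: "u \<in> weighted_H2_0 \<phi> \<Omega>" and \<Omega>: "open \<Omega>" "bounded \<Omega>"
    and L: "0 < L" "4 * emeasure lborel \<Omega> \<le> emeasure lborel (ball (0::real^'n) L)"
  shows "(LINT x:\<Omega>|weighted_measure \<phi>. (u x)\<^sup>2)
    \<le> 4 * (4 * L\<^sup>2)\<^sup>2 * (LINT x:\<Omega>|weighted_measure \<phi>. (drift_laplacian \<phi> \<Omega> u x)\<^sup>2)"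
proof -
  let ?W = "weighted_measure \<phi> :: (real^'n) measure"
  define \<kappa> where "\<kappa> = (4 * L\<^sup>2)\<^sup>2"
  \<comment> \<open>Cutting off by the indicator turns integrals over \<Omega> into integrals over
    the whole space, where test functions already live.\<close>
  define I :: "real^'n \<Rightarrow> real" where "I = indicator \<Omega>"
  have [measurable]: "\<Omega> \<in> sets borel"
    using \<Omega> by simp
  have I_out: "I x = 0" if "x \<notin> \<Omega>" for x
    using that by (simp add: I_def)
  have I_in: "I x = 1" if "x \<in> \<Omega>" for x
    using that by (simp add: I_def)
  define U0 where "U0 = (\<lambda>x. I x * u x)"
  define U1 where "U1 = (\<lambda>i x. I x * weak_partial \<Omega> i u x)"
  define U2 where "U2 = (\<lambda>i j x. I x * weak_partial \<Omega> j (weak_partial \<Omega> i u) x)"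
  have U: "square_integrable ?W U0" "square_integrable ?W (U1 i)" "square_integrable ?W (U2 i j)" for i j
    using u unfolding U0_def U1_def U2_def I_def weighted_H2_0_def weighted_H2_def
    by (auto intro!: weighted_L2_square_integrable)
  obtain \<psi> where \<psi>: "\<And>k::nat. \<psi> k \<in> test_functions \<Omega>"
    and lim: "(\<lambda>k. H2_dist_test \<phi> \<Omega> u (\<psi> k)) \<longlonglongrightarrow> 0"
    using u by (auto simp: weighted_H2_0_def)
  note \<psi>1 = test_function_partial_deriv[OF \<psi>]
  note \<psi>2 = test_function_partial_deriv[OF \<psi>1]
  have "compact (closure \<Omega>)" using \<Omega> by simp
  then have "bounded (drift ` closure \<Omega>)"
    by (intro compact_imp_bounded compact_continuous_image continuous_drift)
  then obtain M where "\<And>x. x \<in> closure \<Omega> \<Longrightarrow> norm (drift x) \<le> M" and M0: "0 < M"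
    unfolding bounded_pos by auto
  then have M: "\<bar>drift x $ i\<bar> \<le> M" if "x \<in> \<Omega>" for x i
    using that closure_subset[of \<Omega>] component_le_norm_cart[of "drift x" i] by (meson order_trans subsetD)
  \<comment> \<open>The drift is bounded on the bounded set \<Omega> but perhaps not globally; after
    the cutoff it is a bounded multiplier and preserves square integrability.\<close>
  define h where "h = (\<lambda>i x. I x * (drift x $ i))"
  have h: "\<bar>h i x\<bar> \<le> M" for i x
    using M[of x i] M0 by (cases "x \<in> \<Omega>") (simp_all add: h_def I_def)
  have h_meas: "h i \<in> borel_measurable ?W" for i
  proof -
    have "(\<lambda>x::real^'n. drift x $ i) \<in> borel_measurable borel"
      by (intro borel_measurable_continuous_onI continuous_on_component continuous_drift)
    then show ?thesis
      by (simp add: h_def I_def)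
  qed
  define Au where "Au = (\<lambda>x. (\<Sum>i\<in>UNIV. U2 i i x) + (\<Sum>i\<in>UNIV. h i x * U1 i x))"
  have Au: "square_integrable ?W Au"
    unfolding Au_def
    by (intro square_integrable_add square_integrable_sum square_integrable_scale_bounded[OF _ h_meas h] U)
  have partial_potential: "partial_deriv i (\<lambda>y. \<phi> (norm y)) x = drift x $ i" for i and x :: "real^'n"
    by (simp add: partial_deriv_eq[OF has_derivative_radial_potential] inner_axis)
  have Au_eq: "I x * (drift_laplacian \<phi> \<Omega> u x)\<^sup>2 = (Au x)\<^sup>2" for x
    by (cases "x \<in> \<Omega>")
      (simp_all add: I_in I_out Au_def U2_def U1_def h_def drift_laplacian_def partial_potential)
  \<comment> \<open>The integrand of the squared distance between \<open>u\<close> and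
    \<open>\<psi> k\<close>, extended by 0 outside \<Omega>; its integral \<tau> tends to 0.\<close>
  define T where "T = (\<lambda>k x. (\<Sum>i\<in>UNIV. \<Sum>j\<in>UNIV. (U2 i j x - partial_deriv j (partial_deriv i (\<psi> k)) x)\<^sup>2)
     + (\<Sum>i\<in>UNIV. (U1 i x - partial_deriv i (\<psi> k) x)\<^sup>2) + (U0 x - \<psi> k x)\<^sup>2)"
  have \<psi>_out: "\<psi> k x = 0" "partial_deriv i (\<psi> k) x = 0" "partial_deriv j (partial_deriv i (\<psi> k)) x = 0"
    if "x \<notin> \<Omega>" for k i j x
    using test_function_eq_0[OF \<psi> that] test_function_eq_0[OF \<psi>1 that] test_function_eq_0[OF \<psi>2 that]
    by auto
  have T_eq: "T k x = I x * ((\<Sum>i\<in>UNIV. \<Sum>j\<in>UNIV.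
          (weak_partial \<Omega> j (weak_partial \<Omega> i u) x - partial_deriv j (partial_deriv i (\<psi> k)) x)\<^sup>2)
     + (\<Sum>i\<in>UNIV. (weak_partial \<Omega> i u x - partial_deriv i (\<psi> k) x)\<^sup>2)
     + (u x - \<psi> k x)\<^sup>2)" for k x
    by (cases "x \<in> \<Omega>") (simp_all add: T_def U0_def U1_def U2_def I_in I_out \<psi>_out)
  have intT: "integrable ?W (T k)" for k
  proof -
    have "integrable ?W (\<lambda>x. (U2 i j x - partial_deriv j (partial_deriv i (\<psi> k)) x)\<^sup>2)"
      "integrable ?W (\<lambda>x. (U1 i x - partial_deriv i (\<psi> k) x)\<^sup>2)"
      "integrable ?W (\<lambda>x. (U0 x - \<psi> k x)\<^sup>2)" for i j
      using square_integrable_diff[OF U(3) test_function_square_integrable[OF \<psi>2]]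
        square_integrable_diff[OF U(2) test_function_square_integrable[OF \<psi>1]]
        square_integrable_diff[OF U(1) test_function_square_integrable[OF \<psi>]]
      unfolding square_integrable_def by blast+
    then show ?thesis
      unfolding T_def by (intro Bochner_Integration.integrable_add Bochner_Integration.integrable_sum)
  qed
  have T_nonneg: "0 \<le> T k x" for k x
    unfolding T_def by (intro add_nonneg_nonneg sum_nonneg) auto
  define \<tau> where "\<tau> = (\<lambda>k. \<integral>x. T k x \<partial>?W)"
  have "\<tau> k = (H2_dist_test \<phi> \<Omega> u (\<psi> k))\<^sup>2" for k
  proof -
    have "H2_dist_test \<phi> \<Omega> u (\<psi> k) = sqrt (\<tau> k)"
      unfolding H2_dist_test_def \<tau>_def T_eq set_lebesgue_integral_def by (simp add: I_def)
    moreover have "0 \<le> \<tau> k"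
      unfolding \<tau>_def by (intro Bochner_Integration.integral_nonneg T_nonneg)
    ultimately show ?thesis by simp
  qed
  then have "\<tau> = (\<lambda>k. (H2_dist_test \<phi> \<Omega> u (\<psi> k))\<^sup>2)"
    by (rule ext)
  then have \<tau>_lim: "\<tau> \<longlonglongrightarrow> 0"
    using tendsto_power[OF lim, of 2] by simp
  define n where "n = real CARD('n)"
  \<comment> \<open>The factor 2 comes from the square of a sum of two terms, \<open>n\<close> from
    Cauchy-Schwarz over the coordinates; \<open>1 + M^2\<close> covers both the second-order terms
    (coefficient 1) and the drift terms (coefficient at most \<open>M\<close>).\<close>
  define c where "c = 2 * n * (1 + M\<^sup>2)"
  have n: "1 \<le> n"
    by (simp add: n_def Suc_leI)
  have key: "(\<integral>x. (U0 x)\<^sup>2 \<partial>?W) \<le> 4 * \<kappa> * (\<integral>x. (Au x)\<^sup>2 \<partial>?W) + (4 * \<kappa> * c + 2) * \<tau> k" for k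
  proof -
    \<comment> \<open>The gap in \<open>U0^2 \<le> 2 * \<psi>^2 + 2 * (U0 - \<psi>)^2\<close> is the
      square of \<open>U0 - 2 * \<psi>\<close>; the same identity serves \<open>Au\<close>
      below.\<close>
    have U0_le: "(U0 x)\<^sup>2 \<le> 2 * (\<psi> k x)\<^sup>2 + 2 * T k x" for x
    proof -
      have "(U0 x - \<psi> k x)\<^sup>2 \<le> T k x"
        unfolding T_def by (simp add: sum_nonneg)
      then show ?thesis
        using zero_le_power2[of "U0 x - 2 * \<psi> k x"] by (simp add: power2_diff power_mult_distrib)
    qed
    have L_le: "(classical_drift_laplacian (\<psi> k) x)\<^sup>2 \<le> 2 * (Au x)\<^sup>2 + 2 * c * T k x" for x
    proof -
      \<comment> \<open>The difference of the two drift Laplacians splits into a second-order part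
        \<alpha>, which sees only the diagonal of the Hessian, and a first-order part
        \<beta>.\<close>
      define \<alpha> where "\<alpha> = (\<lambda>i. U2 i i x - partial_deriv i (partial_deriv i (\<psi> k)) x)"
      define \<beta> where "\<beta> = (\<lambda>i. h i x * (U1 i x - partial_deriv i (\<psi> k) x))"
      have "drift x $ i * partial_deriv i (\<psi> k) x = h i x * partial_deriv i (\<psi> k) x" for i
        by (cases "x \<in> \<Omega>") (simp_all add: h_def I_in \<psi>_out)
      then have "(\<Sum>i\<in>UNIV. drift x $ i * partial_deriv i (\<psi> k) x) = (\<Sum>i\<in>UNIV. h i x * partial_deriv i (\<psi> k) x)"
        by (rule sum.cong[OF refl])
      then have diff: "Au x - classical_drift_laplacian (\<psi> k) x = sum \<alpha> UNIV + sum \<beta> UNIV"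
        by (simp add: Au_def classical_drift_laplacian_def \<alpha>_def \<beta>_def sum_subtractf right_diff_distrib)
      have "(sum \<alpha> UNIV)\<^sup>2 \<le> n * (\<Sum>i\<in>UNIV. (\<alpha> i)\<^sup>2)" "(sum \<beta> UNIV)\<^sup>2 \<le> n * (\<Sum>i\<in>UNIV. (\<beta> i)\<^sup>2)"
        using sum_squared_le_sum_of_squares[of \<alpha> UNIV] sum_squared_le_sum_of_squares[of \<beta> UNIV]
        by (simp_all add: n_def mult.commute)
      moreover have "(\<Sum>i\<in>UNIV. (\<alpha> i)\<^sup>2) \<le> (1 + M\<^sup>2) * (\<Sum>i\<in>UNIV. \<Sum>j\<in>UNIV. (U2 i j x - partial_deriv j (partial_deriv i (\<psi> k)) x)\<^sup>2)"
      proof -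
        have "(\<Sum>i\<in>UNIV. (\<alpha> i)\<^sup>2) \<le> 1 * (\<Sum>i\<in>UNIV. \<Sum>j\<in>UNIV. (U2 i j x - partial_deriv j (partial_deriv i (\<psi> k)) x)\<^sup>2)"
          unfolding mult_1 \<alpha>_def
        proof (rule sum_mono)
          fix i
          show "(U2 i i x - partial_deriv i (partial_deriv i (\<psi> k)) x)\<^sup>2
            \<le> (\<Sum>j\<in>UNIV. (U2 i j x - partial_deriv j (partial_deriv i (\<psi> k)) x)\<^sup>2)"
            by (rule member_le_sum) auto
        qed
        also have "\<dots> \<le> (1 + M\<^sup>2) * (\<Sum>i\<in>UNIV. \<Sum>j\<in>UNIV. (U2 i j x - partial_deriv j (partial_deriv i (\<psi> k)) x)\<^sup>2)"
          by (intro mult_right_mono sum_nonneg) auto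
        finally show ?thesis .
      qed
      moreover have "(\<Sum>i\<in>UNIV. (\<beta> i)\<^sup>2) \<le> (1 + M\<^sup>2) * (\<Sum>i\<in>UNIV. (U1 i x - partial_deriv i (\<psi> k) x)\<^sup>2)"
        unfolding sum_distrib_left
      proof (rule sum_mono)
        fix i
        have "(h i x)\<^sup>2 \<le> M\<^sup>2"
          using h[of i x] M0 by (simp add: power2_le_iff_abs_le)
        then show "(\<beta> i)\<^sup>2 \<le> (1 + M\<^sup>2) * (U1 i x - partial_deriv i (\<psi> k) x)\<^sup>2"
          unfolding \<beta>_def power_mult_distrib by (intro mult_right_mono) auto
      qed
      ultimately have "(sum \<alpha> UNIV)\<^sup>2 + (sum \<beta> UNIV)\<^sup>2 \<le> n * ((1 + M\<^sup>2) * (T k x - (U0 x - \<psi> k x)\<^sup>2))"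
        using n unfolding T_def
        by (smt (verit, best) distrib_left mult_left_mono)
      also have "\<dots> \<le> n * ((1 + M\<^sup>2) * T k x)"
        using n by (intro mult_left_mono) auto
      finally have sq: "2 * ((sum \<alpha> UNIV)\<^sup>2 + (sum \<beta> UNIV)\<^sup>2) \<le> c * T k x"
        by (simp add: c_def)
      have "(sum \<alpha> UNIV + sum \<beta> UNIV)\<^sup>2 \<le> 2 * ((sum \<alpha> UNIV)\<^sup>2 + (sum \<beta> UNIV)\<^sup>2)"
        using zero_le_power2[of "sum \<alpha> UNIV - sum \<beta> UNIV"] by (simp add: power2_diff power2_sum)
      with sq have "(Au x - classical_drift_laplacian (\<psi> k) x)\<^sup>2 \<le> c * T k x"
        unfolding diff by linarith
      moreover have "(classical_drift_laplacian (\<psi> k) x)\<^sup>2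
          \<le> 2 * (Au x)\<^sup>2 + 2 * (Au x - classical_drift_laplacian (\<psi> k) x)\<^sup>2"
        using zero_le_power2[of "2 * Au x - classical_drift_laplacian (\<psi> k) x"]
        by (simp add: power2_diff power_mult_distrib)
      ultimately show ?thesis by simp
    qed
    have int: "integrable ?W (\<lambda>x. (U0 x)\<^sup>2)" "integrable ?W (\<lambda>x. (Au x)\<^sup>2)" "integrable ?W (\<lambda>x. (\<psi> k x)\<^sup>2)"
      using U(1) Au test_function_square_integrable[OF \<psi>, of k] by (simp_all add: square_integrable_def)
    have intL: "integrable ?W (\<lambda>x. (classical_drift_laplacian (\<psi> k) x)\<^sup>2)"
    proof (rule Bochner_Integration.integrable_bound)
      show "integrable ?W (\<lambda>x. 2 * (Au x)\<^sup>2 + 2 * c * T k x)"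
        using int intT by simp
      show "(\<lambda>x. (classical_drift_laplacian (\<psi> k) x)\<^sup>2) \<in> borel_measurable ?W"
        using borel_measurable_continuous_onI[OF continuous_classical_drift_laplacian[OF test_function_smooth[OF \<psi>]], of k]
        by (simp)
      show "AE x in ?W. norm ((classical_drift_laplacian (\<psi> k) x)\<^sup>2) \<le> norm (2 * (Au x)\<^sup>2 + 2 * c * T k x)"
        using L_le by (intro AE_I2) (auto intro: order_trans[OF _ abs_ge_self])
    qed
    have "(\<integral>x. (U0 x)\<^sup>2 \<partial>?W) \<le> (\<integral>x. 2 * (\<psi> k x)\<^sup>2 + 2 * T k x \<partial>?W)"
      using int intT by (intro integral_mono U0_le) auto
    also have "\<dots> = 2 * (\<integral>x. (\<psi> k x)\<^sup>2 \<partial>?W) + 2 * \<tau> k"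
      using int intT by (simp add: \<tau>_def)
    finally have 1: "(\<integral>x. (U0 x)\<^sup>2 \<partial>?W) \<le> 2 * (\<integral>x. (\<psi> k x)\<^sup>2 \<partial>?W) + 2 * \<tau> k" .
    have "(\<integral>x. (classical_drift_laplacian (\<psi> k) x)\<^sup>2 \<partial>?W) \<le> (\<integral>x. 2 * (Au x)\<^sup>2 + 2 * c * T k x \<partial>?W)"
      using int intT intL by (intro integral_mono L_le) auto
    also have "\<dots> = 2 * (\<integral>x. (Au x)\<^sup>2 \<partial>?W) + 2 * c * \<tau> k"
      using int intT by (simp add: \<tau>_def)
    finally have "\<kappa> * (\<integral>x. (classical_drift_laplacian (\<psi> k) x)\<^sup>2 \<partial>?W)
        \<le> \<kappa> * (2 * (\<integral>x. (Au x)\<^sup>2 \<partial>?W) + 2 * c * \<tau> k)"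
      by (rule mult_left_mono) (simp add: \<kappa>_def)
    moreover have "(\<integral>x. (\<psi> k x)\<^sup>2 \<partial>?W) \<le> \<kappa> * (\<integral>x. (classical_drift_laplacian (\<psi> k) x)\<^sup>2 \<partial>?W)"
      unfolding \<kappa>_def by (rule test_function_estimate[OF \<psi> _ L]) simp
    ultimately show ?thesis
      using 1 by (simp add: algebra_simps)
  qed
  have "(\<lambda>k. 4 * \<kappa> * (\<integral>x. (Au x)\<^sup>2 \<partial>?W) + (4 * \<kappa> * c + 2) * \<tau> k)
      \<longlonglongrightarrow> 4 * \<kappa> * (\<integral>x. (Au x)\<^sup>2 \<partial>?W) + (4 * \<kappa> * c + 2) * 0"
    by (intro tendsto_intros \<tau>_lim)
  then have "(\<integral>x. (U0 x)\<^sup>2 \<partial>?W) \<le> 4 * \<kappa> * (\<integral>x. (Au x)\<^sup>2 \<partial>?W)"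
    using key by (intro LIMSEQ_le_const) auto
  moreover have "(LINT x:\<Omega>|?W. (u x)\<^sup>2) = (\<integral>x. (U0 x)\<^sup>2 \<partial>?W)"
    unfolding set_lebesgue_integral_def U0_def I_def
    by (rule Bochner_Integration.integral_cong) (auto simp: indicator_def)
  moreover have "(LINT x:\<Omega>|?W. (drift_laplacian \<phi> \<Omega> u x)\<^sup>2) = (\<integral>x. (Au x)\<^sup>2 \<partial>?W)"
    unfolding set_lebesgue_integral_def Au_eq[symmetric] by (simp add: I_def)
  ultimately show ?thesis
    by (simp add: \<kappa>_def)
qed

text \<open>Testing the weak equation with the eigenfunction itself makes the plate energy equal to
  \<Lambda> times the squared norm of \<open>u\<close>. That norm is positive and cancels from
  \<open>clamped_plate_estimate\<close>.\<close>

lemma plate_eigenvalue_ge: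
  fixes \<Omega> :: "(real^'n) set"
  assumes \<Lambda>: "plate_eigenvalue \<phi> \<Omega> \<Lambda>" and \<Omega>: "open \<Omega>" "bounded \<Omega>"
    and L: "0 < L" "4 * emeasure lborel \<Omega> \<le> emeasure lborel (ball (0::real^'n) L)"
  shows "1 / (4 * (4 * L\<^sup>2)\<^sup>2) \<le> \<Lambda>"
proof -
  let ?W = "weighted_measure \<phi> :: (real^'n) measure"
  obtain u where u: "u \<in> weighted_H2_0 \<phi> \<Omega>" "\<not> (AE x in ?W. x \<in> \<Omega> \<longrightarrow> u x = 0)"
    and eq: "\<And>v. v \<in> weighted_H2_0 \<phi> \<Omega> \<Longrightarrow>
       (LINT x:\<Omega>|?W. drift_laplacian \<phi> \<Omega> u x * drift_laplacian \<phi> \<Omega> v x) = \<Lambda> * (LINT x:\<Omega>|?W. u x * v x)"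
    using \<Lambda> by (auto simp: plate_eigenvalue_def plate_eigenfunction_def)
  define E where "E = (LINT x:\<Omega>|?W. (u x)\<^sup>2)"
  have "u \<in> weighted_L2 \<phi> \<Omega>"
    using u by (simp add: weighted_H2_0_def weighted_H2_def)
  then have int: "integrable ?W (\<lambda>x. indicator \<Omega> x *\<^sub>R (u x)\<^sup>2)"
    by (simp add: weighted_L2_def set_integrable_def)
  have "E \<noteq> 0"
  proof
    assume "E = 0"
    then have "AE x in ?W. indicator \<Omega> x *\<^sub>R (u x)\<^sup>2 = 0"
      unfolding E_def set_lebesgue_integral_def
      by (subst (asm) integral_nonneg_eq_0_iff_AE[OF int]) auto
    then have "AE x in ?W. x \<in> \<Omega> \<longrightarrow> u x = 0"
      by eventually_elim (auto simp: indicator_def)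
    with u show False by simp
  qed
  moreover have "0 \<le> E"
    unfolding E_def set_lebesgue_integral_def by (intro Bochner_Integration.integral_nonneg) auto
  ultimately have "0 < E"
    by simp
  have "(LINT x:\<Omega>|?W. (drift_laplacian \<phi> \<Omega> u x)\<^sup>2) = \<Lambda> * E"
    using eq[OF u(1)] by (simp add: E_def power2_eq_square)
  then have "E \<le> (4 * (4 * L\<^sup>2)\<^sup>2 * \<Lambda>) * E"
    using clamped_plate_estimate[OF u(1) \<Omega> L] by (simp add: E_def mult.assoc)
  then have "1 \<le> 4 * (4 * L\<^sup>2)\<^sup>2 * \<Lambda>"
    using \<open>0 < E\<close> by simp
  then show ?thesis
    using L(1) by (simp add: divide_le_eq mult.commute)
qed

text \<open>The shell between the two radii contains a small ball of positive measure. Consequently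
  the weighted measure of a centered ball determines its radius.\<close>

lemma measure_ball_strict_mono:
  assumes "0 < r" "r < R"
  shows "measure (weighted_measure \<phi>) (ball (0::real^'n) r) < measure (weighted_measure \<phi>) (ball (0::real^'n) R)"
proof -
  let ?W = "weighted_measure \<phi> :: (real^'n) measure"
  define d where "d = (R - r) / 2"
  \<comment> \<open>A point halfway through the shell, on an arbitrary coordinate axis;
    \<open>d\<close> is half the thickness of the shell.\<close>
  define p :: "real^'n" where "p = ((r + R) / 2) *\<^sub>R axis undefined 1"
  have p: "norm p = (r + R) / 2"
    using assms by (simp add: p_def)
  have fin: "emeasure ?W (ball x s) \<noteq> \<infinity>" for x s
    using emeasure_weighted_measure_bounded[of "ball x s"] by simp
  have disj: "ball p d \<inter> ball 0 r = {}"
  proof (rule disjoint_ballI)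
    show "d + r \<le> dist p 0"
      by (simp add: p d_def field_simps)
  qed
  have sub: "ball p d \<union> ball 0 r \<subseteq> ball 0 R"
  proof -
    have "norm x < R" if "dist p x < d" for x
      using that dist_triangle[of 0 x p] p by (simp add: d_def field_simps)
    then have "ball p d \<subseteq> ball 0 R"
      by auto
    then show ?thesis
      using assms by auto
  qed
  have "0 < ennreal (exp (\<phi> 0)) * emeasure lborel (ball p d)"
    using assms by (simp add: ennreal_zero_less_mult_iff emeasure_ball d_def)
  also have "\<dots> \<le> emeasure ?W (ball p d)"
    by (rule emeasure_weighted_measure_ge) simp
  finally have "0 < measure ?W (ball p d)"
    using fin[of p d] by (simp add: measure_def enn2real_positive_iff top.not_eq_extremum)
  then have "measure ?W (ball 0 r) < measure ?W (ball p d) + measure ?W (ball 0 r)"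
    by simp
  also have "\<dots> = measure ?W (ball p d \<union> ball 0 r)"
    by (rule measure_Union[symmetric]) (use fin disj in auto)
  also have "\<dots> \<le> measure ?W (ball 0 R)"
    by (rule measure_mono_fmeasurable[OF sub]) (use fin in \<open>auto simp: fmeasurable_def top.not_eq_extremum\<close>)
  finally show ?thesis .
qed

end

theorem theorem1:
  fixes \<phi> :: "real \<Rightarrow> real"
  assumes "\<And>t. \<phi> (- t) = \<phi> t"
    and "convex_on UNIV \<phi>"
    and "smooth_real \<phi>"
    and "real_analytic (\<lambda>x :: real^'n::finite. \<phi> (norm x))"
  shows "\<exists>C :: real \<Rightarrow> real.
    (\<forall>m>0. 0 < C m \<and> C m \<le> 1) \<and>
    (\<forall>(\<Omega> :: (real^'n) set) R \<Lambda> \<Lambda>s.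
       bounded_smooth_domain \<Omega> \<longrightarrow>
       R > 0 \<longrightarrow>
       measure (weighted_measure \<phi>) (ball (0 :: real^'n) R) = measure (weighted_measure \<phi>) \<Omega> \<longrightarrow>
       lowest_plate_eigenvalue \<phi> \<Omega> \<Lambda> \<longrightarrow>
       lowest_plate_eigenvalue \<phi> (ball (0 :: real^'n) R) \<Lambda>s \<longrightarrow>
       (CARD('n) \<ge> 3 \<or>
        CARD('n) = 2 \<and>
          (\<exists>u. plate_eigenfunction \<phi> (ball (0 :: real^'n) R) \<Lambda>s u \<and> radial_on (ball 0 R) u)) \<longrightarrow>
       \<Lambda> \<ge> C (measure (weighted_measure \<phi>) \<Omega>) * \<Lambda>s)"
proof -
  interpret even_convex_potential \<phi>
    using assms(1-3) by unfold_locales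
  let ?W = "weighted_measure \<phi> :: (real^'n) measure"
  have "\<exists>L>0. 4 * (m / exp (\<phi> 0)) \<le> measure lborel (ball (0::real^'n) L)" for m
  proof -
    define v where "v = unit_ball_vol (real DIM(real^'n))"
    \<comment> \<open>\<open>L \<ge> 1\<close> gives \<open>L \<le> L ^ n\<close>, so the volume
      \<open>v * L ^ n\<close> is at least \<open>v * L\<close>, which the second entry of the
      maximum makes large enough.\<close>
    define L where "L = max 1 (4 * (m / exp (\<phi> 0)) / v)"
    have v: "0 < v"
      by (simp add: v_def)
    have "4 * (m / exp (\<phi> 0)) \<le> v * L"
      using v by (simp add: L_def max_def field_simps)
    also have "\<dots> \<le> v * L ^ DIM(real^'n)"
      using v self_le_power[of L "DIM(real^'n)"] by (intro mult_left_mono) (auto simp: L_def)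
    also have "\<dots> = measure lborel (ball (0::real^'n) L)"
      using content_ball[of L "0::real^'n"] by (simp add: v_def L_def)
    finally show ?thesis
      by (intro exI[of _ L]) (simp add: L_def)
  qed
  then obtain \<L> where \<L>: "\<And>m. 0 < \<L> m" "\<And>m. 4 * (m / exp (\<phi> 0)) \<le> measure lborel (ball (0::real^'n) (\<L> m))"
    by metis
  define lower where "lower = (\<lambda>m. 1 / (4 * (4 * (\<L> m)\<^sup>2)\<^sup>2))"
  have lower_pos: "0 < lower m" for m
    using \<L>(1)[of m] by (simp add: lower_def)
  \<comment> \<open>Stated for arbitrary bounded open sets, because it is applied both to the domain
    and to the ball of equal measure.\<close>
  have lower: "lower (measure ?W \<Omega>) \<le> \<Lambda>" if \<Omega>: "open \<Omega>" "bounded \<Omega>" and "plate_eigenvalue \<phi> \<Omega> \<Lambda>"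
    for \<Omega> :: "(real^'n) set" and \<Lambda>
  proof -
    let ?m = "measure ?W \<Omega>"
    have "emeasure ?W \<Omega> = ennreal ?m"
      using emeasure_weighted_measure_bounded[OF \<Omega>(2)] \<Omega> by (intro emeasure_eq_ennreal_measure) auto
    moreover have lb: "emeasure lborel \<Omega> = ennreal (measure lborel \<Omega>)"
      using emeasure_bounded_finite[OF \<Omega>(2)] by (intro emeasure_eq_ennreal_measure) auto
    ultimately have "exp (\<phi> 0) * measure lborel \<Omega> \<le> ?m"
      using emeasure_weighted_measure_ge[of \<Omega>] \<Omega> by (simp add: ennreal_mult[symmetric])
    then have "4 * measure lborel \<Omega> \<le> 4 * (?m / exp (\<phi> 0))"
      by (simp add: field_simps)
    also note \<L>(2)[of ?m]
    finally have "ennreal (4 * measure lborel \<Omega>) \<le> ennreal (measure lborel (ball (0::real^'n) (\<L> ?m)))"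
      by (rule ennreal_leI)
    also have "\<dots> = emeasure lborel (ball (0::real^'n) (\<L> ?m))"
      using emeasure_bounded_finite[OF bounded_ball, of "0::real^'n" "\<L> ?m"]
      by (intro emeasure_eq_ennreal_measure[symmetric]) auto
    finally have "4 * emeasure lborel \<Omega> \<le> emeasure lborel (ball (0::real^'n) (\<L> ?m))"
      by (simp add: lb ennreal_mult)
    from plate_eigenvalue_ge[OF that(3) \<Omega> \<L>(1) this] show ?thesis
      by (simp add: lower_def)
  qed
  \<comment> \<open>Relates \<open>m\<close> to the lowest eigenvalue of a centered ball of measure
    \<open>m\<close>. It is single-valued: the measure determines the radius, and a lowest
    eigenvalue is unique.\<close>
  define P where "P = (\<lambda>m \<Lambda>s. \<exists>R>0. measure ?W (ball 0 R) = m \<and> lowest_plate_eigenvalue \<phi> (ball (0::real^'n) R) \<Lambda>s)"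
  have P_unique: "x = y" if x: "P m x" and y: "P m y" for m x y
  proof -
    obtain r where r: "0 < r" "measure ?W (ball 0 r) = m" "lowest_plate_eigenvalue \<phi> (ball (0::real^'n) r) x"
      using x unfolding P_def by blast
    obtain s where s: "0 < s" "measure ?W (ball 0 s) = m" "lowest_plate_eigenvalue \<phi> (ball (0::real^'n) s) y"
      using y unfolding P_def by blast
    have "r = s"
      using measure_ball_strict_mono[where 'n='n, of r s] measure_ball_strict_mono[where 'n='n, of s r] r s by (cases r s rule: linorder_cases) auto
    then show ?thesis
      using r s by (auto simp: lowest_plate_eigenvalue_def intro: antisym)
  qed
  \<comment> \<open>The ratio of the universal lower bound to the ball's eigenvalue, capped at 1. It
    refers to \<open>m\<close> alone; the value 1 is a default where no positive ball eigenvalue is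
    available.\<close>
  define C where "C = (\<lambda>m. if \<exists>\<Lambda>s. P m \<Lambda>s \<and> 0 < \<Lambda>s then min 1 (lower m / (THE \<Lambda>s. P m \<Lambda>s)) else 1)"
  have the: "(THE \<Lambda>s. P m \<Lambda>s) = x" if "P m x" for m x
    using that P_unique by blast
  show ?thesis
  proof (intro exI[of _ C] conjI allI impI)
    fix m :: real
    show "0 < C m"
      using the[of m] lower_pos[of m] by (auto simp: C_def)
    show "C m \<le> 1"
      by (simp add: C_def)
  next
    fix \<Omega> :: "(real^'n) set" and R \<Lambda> \<Lambda>s
    assume \<Omega>: "bounded_smooth_domain \<Omega>" and R: "0 < R" "measure ?W (ball 0 R) = measure ?W \<Omega>"
      and \<Lambda>: "lowest_plate_eigenvalue \<phi> \<Omega> \<Lambda>" "lowest_plate_eigenvalue \<phi> (ball (0::real^'n) R) \<Lambda>s"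
    let ?m = "measure ?W \<Omega>"
    have P: "P ?m \<Lambda>s"
      using R \<Lambda>(2) by (auto simp: P_def)
    have low: "lower ?m \<le> \<Lambda>"
      using \<Omega> \<Lambda>(1) by (intro lower) (auto simp: bounded_smooth_domain_def lowest_plate_eigenvalue_def)
    \<comment> \<open>The ball has the same measure, hence the same lower bound; this makes its
      eigenvalue positive and selects the first branch of \<open>C\<close>.\<close>
    have "lower ?m \<le> \<Lambda>s"
      using lower[of "ball 0 R" \<Lambda>s] \<Lambda>(2) R by (auto simp: lowest_plate_eigenvalue_def)
    then have pos: "0 < \<Lambda>s"
      using lower_pos[of ?m] by linarith
    then have "C ?m * \<Lambda>s \<le> lower ?m / \<Lambda>s * \<Lambda>s"
      using P the[OF P] by (intro mult_right_mono) (auto simp: C_def)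
    also have "\<dots> = lower ?m"
      using pos by simp
    finally show "C ?m * \<Lambda>s \<le> \<Lambda>"
      using low by linarith
  qed
qed

end
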